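(* Let $G$ be a locally compact Hausdorff topological group, with left-invariant Haar measure $\mu$, assumed also to be invariant under the inversion $x\mapsto x^{-1}$. Let $1<p<\infty$ and let $k:G\to\mathbb{C}$ be a measurable function. Let $T$ be the convolution operator associated to $k$, defined on continuous compactly supported functions $f:G\to\mathbb{C}$ by $$Tf(x)=(k*f)(x)=\int_G k(y)\,f(y^{-1}x)\,d\mu(y).$$ Then the following are equivalent: (i) $T$ is well defined on continuous compactly supported functions (for each such $f$ the integral converges absolutely for $\mu$-almost every $x$) and extends to a bounded linear operator $T:L^1(G)\to L^{p,\infty}(G)$, i.e. the extension satisfies, for some constant $C$, $\|Tf\|_{L^{p,\infty}(G)}\le C\|f\|_{L^1(G)}$ for every $f\in L^1(G)$; (ii) $k\in L^{p,\infty}(G)$.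
   Context: All Lebesgue spaces on $G$ are taken with respect to the Haar measure $\mu$. For $1<p<\infty$, the weak Lebesgue space $L^{p,\infty}(G)$ consists of the measurable functions $g:G\to\mathbb{C}$ with $$\|g\|_{L^{p,\infty}(G)}:=\sup_{\alpha>0}\alpha\,\mu\{s\in G:|g(s)|>\alpha\}^{1/p}<\infty,$$ functions equal almost everywhere being identified. *)

theory Defs
  imports "HOL-Analysis.Analysis"
begin

text \<open>
  Groups are written additively, following the class \<^class>\<open>topological_group_add\<close>; that
  class does not assume commutativity. Thus \<open>x y\<close>, \<open>x\<^sup>-\<^sup>1\<close> and \<open>y\<^sup>-\<^sup>1 x\<close> are rendered as \<open>x + y\<close>,
  \<open>- x\<close> and \<open>- y + x\<close>, and the order of summands matters.
\<close>

text \<open>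
  A Haar measure is a nonzero left-invariant Radon measure on the Borel sets, where Radon means
  finite on compact sets and inner regular on \<^emph>\<open>all\<close> Borel sets. On \<open>\<sigma>\<close>-compact groups this agrees
  with the other common convention (outer regular on Borel sets, inner regular on open sets).
  On larger groups the latter convention admits locally null Borel sets of infinite measure, such
  as \<open>\<real> \<times> {0}\<close> in \<open>\<real> \<times> \<real>\<close> with the first factor discrete. Convolution with the indicator of such a
  set vanishes, although the indicator has infinite weak norm. With inner regularity, locally null
  Borel sets are null.
\<close>

definition haar_measure :: "'a::{topological_group_add, t2_space} measure \<Rightarrow> bool" where
  "haar_measure M \<longleftrightarrow>
     sets M = sets borel \<and>
     emeasure M UNIV \<noteq> 0 \<and>
     (\<forall>K. compact K \<longrightarrow> emeasure M K < \<infinity>) \<and>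
     (\<forall>A\<in>sets borel. emeasure M A = (SUP K\<in>{K. compact K \<and> K \<subseteq> A}. emeasure M K)) \<and>
     (\<forall>g. \<forall>A\<in>sets borel. emeasure M ((\<lambda>x. g + x) ` A) = emeasure M A)"

definition inversion_invariant :: "'a::topological_group_add measure \<Rightarrow> bool" where
  "inversion_invariant M \<longleftrightarrow> (\<forall>A\<in>sets borel. emeasure M (uminus ` A) = emeasure M A)"

definition ennreal_rpow :: "ennreal \<Rightarrow> real \<Rightarrow> ennreal" where
  "ennreal_rpow t r = (if t = \<infinity> then \<infinity> else ennreal (enn2real t powr r))"

definition weak_Lp_norm :: "'a measure \<Rightarrow> real \<Rightarrow> ('a \<Rightarrow> complex) \<Rightarrow> ennreal" where
  "weak_Lp_norm M p g =
     (SUP \<alpha>\<in>{0::real<..}. ennreal \<alpha> * ennreal_rpow (emeasure M {s\<in>space M. norm (g s) > \<alpha>}) (1 / p))"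

definition weak_Lp :: "'a measure \<Rightarrow> real \<Rightarrow> ('a \<Rightarrow> complex) set" where
  "weak_Lp M p = {g \<in> borel_measurable M. weak_Lp_norm M p g < \<infinity>}"

definition Cc :: "('a::topological_space \<Rightarrow> complex) set" where
  "Cc = {f. continuous_on UNIV f \<and> compact (closure {x. f x \<noteq> 0})}"

definition convolution ::
    "'a::group_add measure \<Rightarrow> ('a \<Rightarrow> complex) \<Rightarrow> ('a \<Rightarrow> complex) \<Rightarrow> 'a \<Rightarrow> complex" where
  "convolution M k f x = (\<integral>y. k y * f (- y + x) \<partial>M)"

definition convolution_well_defined ::
    "'a::{topological_space, group_add} measure \<Rightarrow> ('a \<Rightarrow> complex) \<Rightarrow> bool" where
  "convolution_well_defined M k \<longleftrightarrow>
     (\<forall>f\<in>Cc. AE x in M. integrable M (\<lambda>y. k y * f (- y + x)))"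

text \<open>
  Elements of \<open>L\<^sup>1\<close> and \<open>L\<^bsup>p,\<infinity>\<^esup>\<close> are represented by functions; an operator between the spaces of
  almost-everywhere classes is a map on representatives that respects equality almost everywhere,
  and linearity is required almost everywhere.
\<close>

definition bounded_linear_L1_weak_Lp ::
    "'a measure \<Rightarrow> real \<Rightarrow> (('a \<Rightarrow> complex) \<Rightarrow> 'a \<Rightarrow> complex) \<Rightarrow> bool" where
  "bounded_linear_L1_weak_Lp M p S \<longleftrightarrow>
     (\<forall>f. integrable M f \<longrightarrow> S f \<in> weak_Lp M p) \<and>
     (\<forall>f g. integrable M f \<longrightarrow> integrable M g \<longrightarrow> (AE x in M. f x = g x) \<longrightarrow>
        (AE x in M. S f x = S g x)) \<and>
     (\<forall>f g. integrable M f \<longrightarrow> integrable M g \<longrightarrow>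
        (AE x in M. S (\<lambda>z. f z + g z) x = S f x + S g x)) \<and>
     (\<forall>c f. integrable M f \<longrightarrow> (AE x in M. S (\<lambda>z. c * f z) x = c * S f x)) \<and>
     (\<exists>C::real. \<forall>f. integrable M f \<longrightarrow>
        weak_Lp_norm M p (S f) \<le> ennreal (C * (\<integral>x. norm (f x) \<partial>M)))"

end

theory Submission
  imports Defs
begin

text \<open>
  The weak norm is hard to use under an integral sign because it is not a norm. For \<open>p > 1\<close> it
  is equivalent to one: \<open>\<parallel>g\<parallel>\<^bsub>p,\<infinity>\<^esub>\<close> is comparable to the least \<open>c\<close> such that \<open>\<integral>\<^sub>K \<bar>g\<bar> \<le> c \<mu>(K)\<^bsup>1-1/p\<^esup>\<close>
  for every compact \<open>K\<close> (\<open>weak_Lp_norm_le_if_mean_bound\<close>, \<open>mean_bound_if_weak_Lp_norm\<close>). Inner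
  regularity of the Haar measure makes compact test sets sufficient, even if the group is not
  \<open>\<sigma>\<close>-compact. Both implications of the theorem are proved for this \<open>mean bound\<close>.

  From (ii) to (i): since \<open>\<mu>\<close> is also right invariant, \<open>(k * f)(x) = \<integral> f(z) k(x - z) dz\<close> is an
  average of right translates of \<open>k\<close>, all of which have the same mean bound, so \<open>k * f\<close> has mean
  bound \<open>c \<parallel>f\<parallel>\<^sub>1\<close> (\<open>mean_bound_convolution\<close>). This bound extends the operator from \<open>Cc\<close> to \<open>L\<^sup>1\<close>:
  the extension maps \<open>f\<close> to a function \<open>h\<close> such that \<open>h - k * u\<close> has mean bound \<open>c \<parallel>f - u\<parallel>\<^sub>1\<close> for
  every \<open>u\<close> in \<open>Cc\<close>. Such an \<open>h\<close> is unique almost everywhere because \<open>Cc\<close> is dense, and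
  linearity follows from uniqueness.

  From (i) to (ii): well-definedness forces \<open>k\<close> to be locally integrable. Hence \<open>k * f\<close>
  converges to \<open>k\<close> in \<open>L\<^sup>1(K)\<close> when \<open>f \<ge> 0\<close> has integral \<open>1\<close> and its support shrinks to the unit
  (\<open>approximate_identity\<close>), and the uniform mean bound of the functions \<open>k * f\<close> passes to \<open>k\<close>.

  The group need not be second countable, so a Borel function of \<open>x - z\<close> need not be measurable
  for the product of the Borel \<open>\<sigma>\<close>-algebras and Fubini's theorem is not applicable as it stands.
  The only interchange of integrals is Minkowski's inequality for a continuous kernel
  (\<open>mass_kernel_le\<close>), which follows from a finite partition of a compact set. The kernel \<open>k\<close> is
  replaced by a continuous function, close to it in \<open>L\<^sup>1\<close> of a compact set, before its translates
  are integrated.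
\<close>

lemma ennreal_le_scaled_epsilon:
  fixes x y a :: ennreal
  assumes "a < \<infinity>" and le: "\<And>e::real. 0 < e \<Longrightarrow> x \<le> y + a * ennreal e"
  shows "x \<le> y"
proof (rule ennreal_le_epsilon)
  fix e :: real assume "0 < e"
  define d where "d = e / (enn2real a + 1)"
  have pos: "0 < enn2real a + 1"
    by (simp add: add_nonneg_pos)
  then have "0 < d"
    using \<open>0 < e\<close> by (simp add: d_def)
  have "enn2real a * e \<le> e * (enn2real a + 1)"
    using \<open>0 < e\<close> by (simp add: algebra_simps)
  then have "enn2real a * d \<le> e"
    using pos by (simp add: d_def divide_le_eq)
  moreover have "a * ennreal d = ennreal (enn2real a * d)"
    using assms(1) \<open>0 < d\<close> by (simp add: ennreal_mult less_top)
  ultimately have "a * ennreal d \<le> ennreal e"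
    using \<open>0 < e\<close> by (simp add: ennreal_le_iff)
  then show "x \<le> y + ennreal e"
    using le[OF \<open>0 < d\<close>] by (meson add_left_mono order_trans)
qed

section \<open>Continuous functions of compact support\<close>

lemma compact_diff_image:
  fixes K L :: "'a::topological_group_add set"
  assumes "compact K" "compact L"
  shows "compact ((\<lambda>(x, y). x - y) ` (K \<times> L))"
proof (rule compact_continuous_image)
  show "continuous_on (K \<times> L) (\<lambda>(x, y). x - y)"
    by (simp add: case_prod_unfold) (intro continuous_intros)
qed (intro compact_Times assms)

lemma Cc_continuous: "f \<in> Cc \<Longrightarrow> continuous_on UNIV f"
  by (simp add: Cc_def)

lemma Cc_supportE:
  fixes f :: "'a::t2_space \<Rightarrow> complex"
  assumes "f \<in> Cc"
  obtains S where "compact S" "\<And>x. x \<notin> S \<Longrightarrow> f x = 0"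
  using assms closure_subset[of "{x. f x \<noteq> 0}"] unfolding Cc_def by blast

lemma CcI:
  fixes f :: "'a::t2_space \<Rightarrow> complex"
  assumes "continuous_on UNIV f" "compact S" "\<And>x. x \<notin> S \<Longrightarrow> f x = 0"
  shows "f \<in> Cc"
proof -
  have "closure {x. f x \<noteq> 0} \<subseteq> S"
    by (rule closure_minimal) (use assms compact_imp_closed in auto)
  then have "compact (closure {x. f x \<noteq> 0})"
    using assms(2) by (metis closed_closure compact_Int_closed inf.absorb_iff2)
  with assms(1) show ?thesis
    by (simp add: Cc_def)
qed

lemma Cc_zero: "(\<lambda>x::'a::t2_space. 0) \<in> Cc"
  by (rule CcI[of _ "{}"]) auto

lemma Cc_add:
  fixes f g :: "'a::t2_space \<Rightarrow> complex"
  assumes "f \<in> Cc" "g \<in> Cc"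
  shows "(\<lambda>x. f x + g x) \<in> Cc"
proof -
  obtain S where S: "compact S" "\<And>x. x \<notin> S \<Longrightarrow> f x = 0"
    using Cc_supportE[OF assms(1)] by blast
  obtain T where T: "compact T" "\<And>x. x \<notin> T \<Longrightarrow> g x = 0"
    using Cc_supportE[OF assms(2)] by blast
  show ?thesis
    by (rule CcI[of _ "S \<union> T"])
      (use Cc_continuous[OF assms(1)] Cc_continuous[OF assms(2)] S T in
        \<open>auto intro!: continuous_intros compact_Un\<close>)
qed

lemma Cc_cmult:
  fixes f :: "'a::t2_space \<Rightarrow> complex"
  assumes "f \<in> Cc"
  shows "(\<lambda>x. c * f x) \<in> Cc"
proof -
  obtain S where S: "compact S" "\<And>x. x \<notin> S \<Longrightarrow> f x = 0"
    using Cc_supportE[OF assms(1)] by blast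
  show ?thesis
    by (rule CcI[of _ S]) (use Cc_continuous[OF assms] S in \<open>auto intro!: continuous_intros\<close>)
qed

lemma Cc_diff:
  fixes f g :: "'a::t2_space \<Rightarrow> complex"
  assumes "f \<in> Cc" "g \<in> Cc"
  shows "(\<lambda>x. f x - g x) \<in> Cc"
  using Cc_add[OF assms(1) Cc_cmult[OF assms(2), of "-1"]] by simp

lemma compact_nbhd_inside:
  fixes W :: "'a::t2_space set"
  assumes "locally_compact_space (euclidean :: 'a topology)" "open W" "x \<in> W"
  obtains U C where "open U" "compact C" "x \<in> U" "U \<subseteq> C" "C \<subseteq> W"
proof -
  have "Hausdorff_space (euclidean :: 'a topology)"
    by (metis (no_types, opaque_lifting) Hausdorff_space_def disjnt_def hausdorff open_openin)
  then have "neighbourhood_base_of (\<lambda>C. compactin euclidean C \<and> closedin euclidean C)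
      (euclidean :: 'a topology)"
    using assms(1) locally_compact_space_neighbourhood_base_closedin by blast
  then show thesis
    using assms(2,3) that unfolding neighbourhood_base_of by (metis compactin_euclidean_iff open_openin)
qed

text \<open>
  Urysohn's lemma for a compact set inside an open set. Complete regularity gives for each point
  of \<open>K\<close> a function that is \<open>1\<close> there and is supported in a compact neighbourhood of that point
  inside \<open>W\<close>. By compactness there are finitely many of them such that at each point of \<open>K\<close> one
  exceeds \<open>1/2\<close>; twice their sum, cut off at \<open>1\<close>, is as required.
\<close>

lemma Cc_bump:
  fixes K W :: "'a::t2_space set"
  assumes lc: "locally_compact_space (euclidean :: 'a topology)"
    and "compact K" "open W" "K \<subseteq> W"
  shows "\<exists>u :: 'a \<Rightarrow> real. (\<lambda>x. complex_of_real (u x)) \<in> Cc \<and> (\<forall>x. 0 \<le> u x) \<and> (\<forall>x. u x \<le> 1)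
    \<and> (\<forall>x\<in>K. u x = 1) \<and> (\<forall>x. x \<notin> W \<longrightarrow> u x = 0)"
proof -
  have H: "Hausdorff_space (euclidean :: 'a topology)"
    by (metis (no_types, opaque_lifting) Hausdorff_space_def disjnt_def hausdorff open_openin)
  have cr: "completely_regular_space (euclidean :: 'a topology)"
    using lc H locally_compact_regular_imp_completely_regular_space by blast
  have "\<exists>(f :: 'a \<Rightarrow> real) C. continuous_on UNIV f \<and> compact C \<and> C \<subseteq> W \<and> f x = 1 \<and> (\<forall>y. 0 \<le> f y)
      \<and> (\<forall>y. y \<notin> C \<longrightarrow> f y = 0)" if "x \<in> K" for x
  proof -
    obtain U C where UC: "open U" "compact C" "x \<in> U" "U \<subseteq> C" "C \<subseteq> W"
      using compact_nbhd_inside[OF lc \<open>open W\<close>, of x] \<open>x \<in> K\<close> \<open>K \<subseteq> W\<close> by blast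
    have "closedin euclidean (- U)" "x \<in> topspace euclidean - (- U)"
      using UC by (auto simp flip: closed_closedin)
    then obtain f where f: "continuous_map euclidean (top_of_set {0..1::real}) f"
        "f x = 0" "f ` (- U) \<subseteq> {1}"
      using cr unfolding completely_regular_space_def by blast
    have rng: "f y \<le> 1" for y
      using f(1) by (auto simp: continuous_map_in_subtopology image_subset_iff)
    have "continuous_on UNIV f"
      using f(1) by (simp add: continuous_map_in_subtopology)
    moreover have "y \<notin> C \<Longrightarrow> 1 - f y = 0" for y
      using f(3) UC by auto
    ultimately show ?thesis
      using f UC rng by (intro exI[of _ "\<lambda>y. 1 - f y"] exI[of _ C]) (auto intro!: continuous_intros)
  qed
  then have "\<forall>x\<in>K. \<exists>(f :: 'a \<Rightarrow> real) C. continuous_on UNIV f \<and> compact C \<and> C \<subseteq> W \<and> f x = 1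
      \<and> (\<forall>y. 0 \<le> f y) \<and> (\<forall>y. y \<notin> C \<longrightarrow> f y = 0)"
    by blast
  then obtain f :: "'a \<Rightarrow> 'a \<Rightarrow> real" and C where
      "\<forall>x\<in>K. continuous_on UNIV (f x) \<and> compact (C x) \<and> C x \<subseteq> W \<and> f x x = 1
        \<and> (\<forall>y. 0 \<le> f x y) \<and> (\<forall>y. y \<notin> C x \<longrightarrow> f x y = 0)"
    unfolding bchoice_iff by blast
  then have fC: "\<And>x. x \<in> K \<Longrightarrow> continuous_on UNIV (f x)"
      "\<And>x. x \<in> K \<Longrightarrow> compact (C x)" "\<And>x. x \<in> K \<Longrightarrow> C x \<subseteq> W" "\<And>x. x \<in> K \<Longrightarrow> f x x = 1"
      "\<And>x y. x \<in> K \<Longrightarrow> 0 \<le> f x y" "\<And>x y. x \<in> K \<Longrightarrow> y \<notin> C x \<Longrightarrow> f x y = 0"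
    by blast+
  have "open {y. 1/2 < f x y}" if "x \<in> K" for x
    using fC(1)[OF that] by (intro open_Collect_less continuous_intros) auto
  moreover have "K \<subseteq> (\<Union>x\<in>K. {y. 1/2 < f x y})"
    using fC(4) by force
  ultimately obtain D where D: "D \<subseteq> K" "finite D" "K \<subseteq> (\<Union>x\<in>D. {y. 1/2 < f x y})"
    using compactE_image[OF \<open>compact K\<close>, of K "\<lambda>x. {y. 1/2 < f x y}"] by metis
  define u where "u y = min 1 (2 * (\<Sum>x\<in>D. f x y))" for y
  have cont: "continuous_on UNIV u"
    unfolding u_def using D fC(1) by (intro continuous_intros) auto
  have nonneg: "0 \<le> (\<Sum>x\<in>D. f x y)" for y
    using D fC(5) by (intro sum_nonneg) auto
  have zero: "u y = 0" if "y \<notin> (\<Union>x\<in>D. C x)" for y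
  proof -
    have "(\<Sum>x\<in>D. f x y) = 0"
      using D fC(6) that by (intro sum.neutral) auto
    then show ?thesis
      by (simp add: u_def)
  qed
  have one: "u y = 1" if "y \<in> K" for y
  proof -
    obtain x where x: "x \<in> D" "1/2 < f x y"
      using D(3) \<open>y \<in> K\<close> by blast
    have "f x y \<le> (\<Sum>x\<in>D. f x y)"
      using D fC(5) x by (intro member_le_sum) auto
    then show ?thesis
      using x by (simp add: u_def)
  qed
  show ?thesis
  proof (intro exI conjI allI ballI impI)
    show "(\<lambda>x. complex_of_real (u x)) \<in> Cc"
      by (rule CcI[of _ "\<Union>x\<in>D. C x"])
        (use cont D fC(2) zero in \<open>auto intro!: continuous_intros compact_UN\<close>)
    show "u x = 0" if "x \<notin> W" for x
      using zero[of x] D fC(3) that by blast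
  qed (use nonneg one in \<open>auto simp: u_def\<close>)
qed

section \<open>Haar measure: regularity and invariance\<close>

locale unimodular_haar_measure =
  fixes M :: "'a::{topological_group_add, t2_space} measure"
  assumes locally_compact: "locally_compact_space (euclidean :: 'a topology)"
    and haar: "haar_measure M"
    and inversion: "inversion_invariant M"
begin

lemma sets_M [simp, measurable_cong]: "sets M = sets borel"
  using haar by (simp add: haar_measure_def)

lemma space_M [simp]: "space M = UNIV"
  using sets_eq_imp_space_eq[OF sets_M] by simp

lemma borel_measurable_continuous:
  "continuous_on UNIV f \<Longrightarrow> f \<in> borel_measurable M"
  for f :: "'a \<Rightarrow> 'b::topological_space"
  using borel_measurable_continuous_onI measurable_cong_sets[OF sets_M refl] by blast

lemma compact_in_sets: "compact K \<Longrightarrow> K \<in> sets M"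
  by (simp add: borel_compact)

lemma emeasure_compact: "compact K \<Longrightarrow> emeasure M K < \<infinity>"
  using haar by (simp add: haar_measure_def)

lemma emeasure_compact_eq: "compact K \<Longrightarrow> emeasure M K = ennreal (measure M K)"
  using emeasure_compact[of K] by (simp add: emeasure_eq_ennreal_measure)

lemma inner_regular:
  "A \<in> sets M \<Longrightarrow> emeasure M A = (SUP K\<in>{K. compact K \<and> K \<subseteq> A}. emeasure M K)"
  using haar by (simp add: haar_measure_def)

text \<open>
  The group need not be a countable union of compact sets, so null sets on compact pieces cannot
  simply be collected. Instead, the exceptional set contains only null compact sets, so it is
  null by inner regularity.
\<close>

lemma AE_if_AE_on_compact:
  assumes meas: "{x. \<not> P x} \<in> sets M"
    and ae: "\<And>K. compact K \<Longrightarrow> AE x in M. x \<in> K \<longrightarrow> P x"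
  shows "AE x in M. P x"
proof (rule AE_I)
  show "{x \<in> space M. \<not> P x} \<subseteq> {x. \<not> P x}"
    by simp
  have "emeasure M K = 0" if "compact K" "K \<subseteq> {x. \<not> P x}" for K
  proof -
    have "AE x in M. x \<notin> K"
      using ae[OF that(1)] by eventually_elim (use that in auto)
    then show ?thesis
      by (subst (asm) AE_iff_measurable[of K]) (auto simp: compact_in_sets that simp del: sets_M)
  qed
  then have "emeasure M {x. \<not> P x} \<le> 0"
    unfolding inner_regular[OF meas] by (intro SUP_least) simp
  then show "emeasure M {x. \<not> P x} = 0"
    by simp
qed fact

lemma measurable_continuous_self: "continuous_on UNIV (t :: 'a \<Rightarrow> 'a) \<Longrightarrow> t \<in> measurable M M"
  using borel_measurable_continuous_onI[of t] measurable_cong_sets[OF sets_M sets_M] by blast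

lemma distr_translate_left: "distr M M (\<lambda>x. g + x) = M"
proof (rule measure_eqI)
  have t: "(\<lambda>x. g + x) \<in> measurable M M"
    by (intro measurable_continuous_self continuous_intros)
  fix A assume A: "A \<in> sets (distr M M (\<lambda>x. g + x))"
  have "(\<lambda>x. g + x) -` A = (\<lambda>x. - g + x) ` A"
    by (force simp: image_iff simp flip: add.assoc)
  then show "emeasure (distr M M (\<lambda>x. g + x)) A = emeasure M A"
    using A haar t by (simp add: emeasure_distr haar_measure_def)
qed simp

lemma distr_uminus: "distr M M uminus = M"
proof (rule measure_eqI)
  have t: "uminus \<in> measurable M M"
    by (intro measurable_continuous_self continuous_intros)
  fix A assume A: "A \<in> sets (distr M M uminus)"
  have "uminus -` A = uminus ` A"
    by (force simp: image_iff)
  then show "emeasure (distr M M uminus) A = emeasure M A"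
    using A inversion t by (simp add: emeasure_distr inversion_invariant_def)
qed simp

lemma distr_compose:
  assumes "distr M M s = M" "distr M M t = M" "continuous_on UNIV s" "continuous_on UNIV t"
  shows "distr M M (\<lambda>x. s (t x)) = M"
  using distr_distr[of s M M t M] assms by (simp add: comp_def measurable_continuous_self)

text \<open>
  The substitution \<open>z = - y + x\<close> turns \<open>\<integral> k(y) f(- y + x) dy\<close> into an integral against \<open>f(z)\<close>.
  It is the inversion after a left translation, since \<open>- y + x = - (- x + y)\<close>.
\<close>

lemma distr_reflect: "distr M M (\<lambda>y. - y + x) = M"
proof -
  have "distr M M (\<lambda>y. - (- x + y)) = M"
    by (rule distr_compose[OF distr_uminus distr_translate_left]) (intro continuous_intros)+
  then show ?thesis
    by (simp add: minus_add)
qed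

text \<open>
  Right translation by \<open>g\<close> is \<open>y \<mapsto> - y + g\<close> after the inversion; here the hypothesis that the
  measure is inversion invariant makes the group unimodular.
\<close>

lemma distr_translate_right: "distr M M (\<lambda>x. x + g) = M"
proof -
  have "distr M M (\<lambda>x. - (- x) + g) = M"
    by (rule distr_compose[OF distr_reflect distr_uminus]) (intro continuous_intros)+
  then show ?thesis
    by simp
qed

lemma nn_integral_invariant:
  assumes "distr M M t = M" "continuous_on UNIV t" "f \<in> borel_measurable M"
  shows "(\<integral>\<^sup>+x. f (t x) \<partial>M) = (\<integral>\<^sup>+x. f x \<partial>M)"
  using nn_integral_distr[of t M M f] assms by (simp add: measurable_continuous_self)

lemma integral_invariant:
  fixes f :: "'a \<Rightarrow> complex"
  assumes "distr M M t = M" "continuous_on UNIV t" "f \<in> borel_measurable M"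
  shows "(\<integral>x. f (t x) \<partial>M) = (\<integral>x. f x \<partial>M)"
  using integral_distr[of t M M f] assms by (simp add: measurable_continuous_self)

section \<open>Integrals of the absolute value over a set\<close>

definition mass :: "'a set \<Rightarrow> ('a \<Rightarrow> complex) \<Rightarrow> ennreal" where
  "mass A g = (\<integral>\<^sup>+x. ennreal (norm (g x)) * indicator A x \<partial>M)"

lemma mass_UNIV: "mass UNIV g = (\<integral>\<^sup>+x. ennreal (norm (g x)) \<partial>M)"
  by (simp add: mass_def)

lemma mass_mono: "(\<And>x. x \<in> A \<Longrightarrow> norm (g x) \<le> norm (h x)) \<Longrightarrow> mass A g \<le> mass A h"
  unfolding mass_def by (intro nn_integral_mono) (auto simp: indicator_def ennreal_leI)

lemma mass_cong: "(\<And>x. x \<in> A \<Longrightarrow> g x = h x) \<Longrightarrow> mass A g = mass A h"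
  by (intro antisym mass_mono) auto

lemma mass_mono_set: "A \<subseteq> B \<Longrightarrow> mass A g \<le> mass B g"
  unfolding mass_def by (intro nn_integral_mono) (auto simp: indicator_def)

lemma mass_add:
  assumes "g \<in> borel_measurable M" "h \<in> borel_measurable M" "A \<in> sets M"
  shows "mass A (\<lambda>x. g x + h x) \<le> mass A g + mass A h"
proof -
  have "mass A (\<lambda>x. g x + h x)
      \<le> (\<integral>\<^sup>+x. ennreal (norm (g x)) * indicator A x + ennreal (norm (h x)) * indicator A x \<partial>M)"
    unfolding mass_def
  proof (rule nn_integral_mono)
    fix x
    have "ennreal (norm (g x + h x)) \<le> ennreal (norm (g x)) + ennreal (norm (h x))"
      by (metis ennreal_leI ennreal_plus norm_ge_zero norm_triangle_ineq)
    then show "ennreal (norm (g x + h x)) * indicator A x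
        \<le> ennreal (norm (g x)) * indicator A x + ennreal (norm (h x)) * indicator A x"
      by (cases "x \<in> A") simp_all
  qed
  also have "\<dots> = mass A g + mass A h"
    unfolding mass_def using assms by (intro nn_integral_add) auto
  finally show ?thesis .
qed

lemma mass_minus_commute: "mass A (\<lambda>x. g x - h x) = mass A (\<lambda>x. h x - g x)"
  by (simp add: mass_def norm_minus_commute)

lemma mass_triangle:
  assumes "g \<in> borel_measurable M" "h \<in> borel_measurable M" "k \<in> borel_measurable M" "A \<in> sets M"
  shows "mass A (\<lambda>x. g x - k x) \<le> mass A (\<lambda>x. g x - h x) + mass A (\<lambda>x. h x - k x)"
  using mass_add[of "\<lambda>x. g x - h x" "\<lambda>x. h x - k x" A] assms by (simp add: borel_measurable_diff)

lemma mass_cmult: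
  assumes "g \<in> borel_measurable M" "A \<in> sets M"
  shows "mass A (\<lambda>x. c * g x) = ennreal (norm c) * mass A g"
proof -
  have "mass A (\<lambda>x. c * g x) = (\<integral>\<^sup>+x. ennreal (norm c) * (ennreal (norm (g x)) * indicator A x) \<partial>M)"
    unfolding mass_def by (simp add: norm_mult ennreal_mult mult.assoc)
  then show ?thesis
    unfolding mass_def using assms by (simp add: nn_integral_cmult)
qed

lemma mass_indicator: "mass A (\<lambda>x. indicator B x * g x) = mass (A \<inter> B) g"
  unfolding mass_def by (intro nn_integral_cong) (auto simp: indicator_def)

lemma integrable_iff_mass:
  "integrable M g \<longleftrightarrow> g \<in> borel_measurable M \<and> mass UNIV g < \<infinity>"
  by (simp add: integrable_iff_bounded mass_UNIV)

lemma AE_eq_if_mass_zero: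
  assumes "g \<in> borel_measurable M" "h \<in> borel_measurable M"
    and "\<And>K. compact K \<Longrightarrow> mass K (\<lambda>x. g x - h x) = 0"
  shows "AE x in M. g x = h x"
proof (rule AE_if_AE_on_compact)
  have "(\<lambda>x. g x - h x) -` (- {0}) \<inter> space M \<in> sets M"
    by (intro measurable_sets[OF borel_measurable_diff[OF assms(1,2)]]) auto
  moreover have "(\<lambda>x. g x - h x) -` (- {0}) \<inter> space M = {x. \<not> g x = h x}"
    by auto
  ultimately show "{x. \<not> g x = h x} \<in> sets M"
    by simp
  fix K :: "'a set" assume "compact K"
  have "AE x in M. ennreal (norm (g x - h x)) * indicator K x = 0"
    using assms(3)[OF \<open>compact K\<close>] assms(1,2) compact_in_sets[OF \<open>compact K\<close>]
    unfolding mass_def by (subst (asm) nn_integral_0_iff_AE) (auto simp del: sets_M)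
  then show "AE x in M. x \<in> K \<longrightarrow> g x = h x"
    by eventually_elim (auto simp: indicator_def)
qed

lemma Cc_borel: "f \<in> Cc \<Longrightarrow> f \<in> borel_measurable M"
  by (simp add: Cc_continuous borel_measurable_continuous)

lemma Cc_boundedE:
  fixes f :: "'a \<Rightarrow> complex"
  assumes "f \<in> Cc"
  obtains B where "0 \<le> B" "\<And>x. norm (f x) \<le> B"
proof -
  obtain S where S: "compact S" "\<And>x. x \<notin> S \<Longrightarrow> f x = 0"
    using Cc_supportE[OF assms] by blast
  have "compact (f ` S)"
    using compact_continuous_image[OF _ S(1)] continuous_on_subset[OF Cc_continuous[OF assms]]
    by blast
  then obtain B where B: "\<forall>y\<in>f ` S. norm y \<le> B"
    using compact_imp_bounded bounded_iff by blast
  have "norm (f x) \<le> max 0 B" for x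
    using B S(2)[of x] by (cases "x \<in> S") auto
  then show thesis
    using that[of "max 0 B"] by auto
qed

lemma Cc_integrable:
  assumes "f \<in> Cc"
  shows "integrable M f"
proof -
  obtain S where S: "compact S" "\<And>x. x \<notin> S \<Longrightarrow> f x = 0"
    using Cc_supportE[OF assms] by blast
  obtain B where B: "0 \<le> B" "\<And>x. norm (f x) \<le> B"
    using Cc_boundedE[OF assms] by blast
  have "(\<integral>\<^sup>+x. ennreal (norm (f x)) \<partial>M) \<le> (\<integral>\<^sup>+x. ennreal B * indicator S x \<partial>M)"
    using B S by (intro nn_integral_mono) (auto simp: indicator_def ennreal_leI)
  also have "\<dots> = ennreal B * emeasure M S"
    using compact_in_sets[OF S(1)] by (rule nn_integral_cmult_indicator)
  also have "\<dots> < \<infinity>"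
    using emeasure_compact[OF S(1)] by (simp add: ennreal_mult_less_top)
  finally show ?thesis
    using Cc_borel[OF assms] by (simp add: integrable_iff_bounded)
qed

section \<open>Density in the integrable functions\<close>

lemma compact_inner_approxE:
  assumes "A \<in> sets M" "emeasure M A < \<infinity>" "0 < (e :: real)"
  obtains K where "compact K" "K \<subseteq> A" "emeasure M (A - K) \<le> ennreal e"
proof -
  have "\<exists>K\<in>{K. compact K \<and> K \<subseteq> A}. emeasure M A < emeasure M K + ennreal e"
    by (rule SUP_approx_ennreal[OF assms(3) _ inner_regular[OF assms(1)]]) (use assms(2) in auto)
  then obtain K where K: "compact K" "K \<subseteq> A" "emeasure M A < emeasure M K + ennreal e"
    by blast
  have "emeasure M K + emeasure M (A - K) = emeasure M A"
    using plus_emeasure[of K M "A - K"] compact_in_sets[OF K(1)] assms(1) K(2)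
    by (simp add: Un_absorb1)
  then have "emeasure M K + emeasure M (A - K) \<le> emeasure M K + ennreal e"
    using K(3) by simp
  then have "emeasure M (A - K) \<le> ennreal e"
    using emeasure_compact[OF K(1)] by (auto simp: ennreal_add_left_cancel_le)
  with K show thesis
    using that by blast
qed

text \<open>
  Outer regularity at a compact set follows from inner regularity: enclose \<open>K\<close> in an open set
  \<open>V\<close> of finite measure, and remove from \<open>V\<close> a compact subset that carries almost all of \<open>V -
  K\<close>.
\<close>

lemma open_outer_approxE:
  assumes "compact K" "0 < (e :: real)"
  obtains W where "open W" "K \<subseteq> W" "emeasure M (W - K) \<le> ennreal e"
proof -
  obtain u :: "'a \<Rightarrow> real" where u: "(\<lambda>x. complex_of_real (u x)) \<in> Cc" "\<And>x. 0 \<le> u x"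
      "\<And>x. u x \<le> 1" "\<And>x. x \<in> K \<Longrightarrow> u x = 1"
    using Cc_bump[OF locally_compact assms(1) open_UNIV subset_UNIV] by blast
  obtain S where S: "compact S" "\<And>x. x \<notin> S \<Longrightarrow> complex_of_real (u x) = 0"
    using Cc_supportE[OF u(1)] by blast
  define V where "V = {x. complex_of_real (u x) \<noteq> 0}"
  have V: "open V" "K \<subseteq> V" "V \<subseteq> S"
    using u(4) S(2) open_Collect_neq[OF Cc_continuous[OF u(1)], of "\<lambda>x. 0"] by (auto simp: V_def)
  have VK: "V - K \<in> sets M"
    using V(1) compact_in_sets[OF assms(1)] by (intro sets.Diff) auto
  have "emeasure M (V - K) \<le> emeasure M S"
    using V(3) compact_in_sets[OF S(1)] by (intro emeasure_mono) auto
  then have "emeasure M (V - K) < \<infinity>"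
    using emeasure_compact[OF S(1)] by (rule order_le_less_trans)
  then obtain L where L: "compact L" "L \<subseteq> V - K" "emeasure M (V - K - L) \<le> ennreal e"
    using compact_inner_approxE[OF VK _ assms(2)] by blast
  show thesis
  proof
    show "open (V - L)"
      using V(1) compact_imp_closed[OF L(1)] by blast
    show "K \<subseteq> V - L"
      using V(2) L(2) by blast
    have "V - L - K = V - K - L"
      by blast
    then show "emeasure M (V - L - K) \<le> ennreal e"
      using L(3) by simp
  qed
qed

lemma Cc_approx_indicatorE:
  assumes "A \<in> sets M" "emeasure M A < \<infinity>" "0 < (e :: real)"
  obtains u where "u \<in> Cc" "mass UNIV (\<lambda>x. indicator A x - u x) \<le> ennreal e"
proof -
  have "0 < e / 2"
    using assms(3) by simp
  obtain K where K: "compact K" "K \<subseteq> A" "emeasure M (A - K) \<le> ennreal (e / 2)"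
    by (rule compact_inner_approxE[OF assms(1,2) \<open>0 < e / 2\<close>])
  obtain W where W: "open W" "K \<subseteq> W" "emeasure M (W - K) \<le> ennreal (e / 2)"
    by (rule open_outer_approxE[OF K(1) \<open>0 < e / 2\<close>])
  obtain u :: "'a \<Rightarrow> real" where u: "(\<lambda>x. complex_of_real (u x)) \<in> Cc" "\<And>x. 0 \<le> u x"
      "\<And>x. u x \<le> 1" "\<And>x. x \<in> K \<Longrightarrow> u x = 1" "\<And>x. x \<notin> W \<Longrightarrow> u x = 0"
    using Cc_bump[OF locally_compact K(1) W(1,2)] by blast
  have sets: "A - K \<in> sets M" "W - K \<in> sets M"
    using assms(1) W(1) compact_in_sets[OF K(1)] by (auto intro!: sets.Diff simp del: sets_M simp: sets_M[symmetric])
  have pt: "ennreal (norm (indicator A x - complex_of_real (u x)))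
      \<le> indicator (A - K) x + indicator (W - K) x" for x
  proof (cases "x \<in> K")
    case True
    then show ?thesis
      using K(2) u(4) by (auto simp: indicator_def)
  next
    case False
    have "indicator A x - complex_of_real (u x) = complex_of_real (indicator A x - u x)"
      by (simp add: indicator_def)
    moreover have "\<bar>indicator A x - u x\<bar> \<le> 1"
      using u(2)[of x] u(3)[of x] by (simp add: indicator_def)
    ultimately have "norm (indicator A x - complex_of_real (u x)) \<le> 1"
      by (simp only: norm_of_real)
    then have le1: "ennreal (norm (indicator A x - complex_of_real (u x))) \<le> 1"
      using ennreal_leI[of _ 1] by simp
    show ?thesis
    proof (cases "x \<in> A \<or> x \<in> W")
      case True
      have "1 \<le> (indicator (A - K) x + indicator (W - K) x :: ennreal)"
        using True False by (auto simp: indicator_def)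
      with le1 show ?thesis
        by (rule order_trans)
    next
      case False
      then show ?thesis
        using u(5)[of x] by simp
    qed
  qed
  have "mass UNIV (\<lambda>x. indicator A x - complex_of_real (u x))
      \<le> (\<integral>\<^sup>+x. indicator (A - K) x + indicator (W - K) x \<partial>M)"
    unfolding mass_UNIV by (intro nn_integral_mono pt)
  also have "\<dots> = emeasure M (A - K) + emeasure M (W - K)"
    using sets by (subst nn_integral_add) auto
  also have "\<dots> \<le> ennreal (e / 2) + ennreal (e / 2)"
    using K(3) W(3) by (rule add_mono)
  also have "\<dots> = ennreal e"
    using assms(3) by (simp flip: ennreal_plus)
  finally show thesis
    using that u(1) by blast
qed

lemma Cc_dense_L1:
  assumes "integrable M f" "0 < (e :: real)"
  shows "\<exists>u\<in>Cc. mass UNIV (\<lambda>x. f x - u x) \<le> ennreal e"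
  using assms
proof (induction arbitrary: e rule: integrable_induct)
  case (base A c)
  define d where "d = e / (norm c + 1)"
  have "0 < d"
    using base.prems by (simp add: d_def add_nonneg_pos)
  then obtain u where u: "u \<in> Cc" "mass UNIV (\<lambda>x. indicator A x - u x) \<le> ennreal d"
    using Cc_approx_indicatorE[OF base.hyps] by blast
  have meas: "(\<lambda>x. indicator A x - u x) \<in> borel_measurable M"
    using base.hyps(1) Cc_borel[OF u(1)] by (intro borel_measurable_diff borel_measurable_indicator)
  have "mass UNIV (\<lambda>x. indicat_real A x *\<^sub>R c - c * u x) = mass UNIV (\<lambda>x. c * (indicator A x - u x))"
    by (intro mass_cong) (simp add: indicator_def algebra_simps)
  also have "\<dots> = ennreal (norm c) * mass UNIV (\<lambda>x. indicator A x - u x)"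
    using meas by (intro mass_cmult) auto
  also have "\<dots> \<le> ennreal (norm c) * ennreal d"
    using u(2) by (rule mult_left_mono) simp
  also have "\<dots> = ennreal (norm c * d)"
    using \<open>0 < d\<close> by (simp add: ennreal_mult)
  also have "\<dots> \<le> ennreal e"
  proof (rule ennreal_leI)
    have "norm c * e \<le> e * (norm c + 1)"
      using base.prems by (simp add: algebra_simps)
    then show "norm c * d \<le> e"
      by (simp add: d_def divide_le_eq add_nonneg_pos)
  qed
  finally show ?case
    by (intro bexI[of _ "\<lambda>x. c * u x"] Cc_cmult u(1))
next
  case (add f g)
  have "0 < e / 2"
    using add.prems by simp
  obtain u where u: "u \<in> Cc" "mass UNIV (\<lambda>x. f x - u x) \<le> ennreal (e / 2)"
    using add.IH(1)[OF \<open>0 < e / 2\<close>] by blast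
  obtain v where v: "v \<in> Cc" "mass UNIV (\<lambda>x. g x - v x) \<le> ennreal (e / 2)"
    using add.IH(2)[OF \<open>0 < e / 2\<close>] by blast
  have "mass UNIV (\<lambda>x. f x + g x - (u x + v x)) = mass UNIV (\<lambda>x. (f x - u x) + (g x - v x))"
    by (intro mass_cong) simp
  also have "\<dots> \<le> mass UNIV (\<lambda>x. f x - u x) + mass UNIV (\<lambda>x. g x - v x)"
    using add.hyps Cc_borel[OF u(1)] Cc_borel[OF v(1)]
    by (intro mass_add borel_measurable_diff) auto
  also have "\<dots> \<le> ennreal (e / 2) + ennreal (e / 2)"
    using u(2) v(2) by (rule add_mono)
  also have "\<dots> = ennreal e"
    using add.prems by (simp flip: ennreal_plus)
  finally show ?case
    by (intro bexI[of _ "\<lambda>x. u x + v x"] Cc_add u(1) v(1))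
next
  case (lim f s)
  have "0 < e / 2"
    using lim.prems by simp
  have "(\<lambda>i. \<integral>\<^sup>+x. norm (f x - s i x) \<partial>M) \<longlonglongrightarrow> 0"
  proof (rule nn_integral_dominated_convergence_norm[where w = "\<lambda>x. 2 * norm (f x)"])
    show "(\<integral>\<^sup>+x. ennreal (2 * norm (f x)) \<partial>M) < \<infinity>"
      using lim.hyps(4) by (auto simp: ennreal_mult nn_integral_cmult ennreal_mult_less_top
          integrable_iff_bounded)
  qed (use lim.hyps in auto)
  then have "eventually (\<lambda>i. (\<integral>\<^sup>+x. norm (f x - s i x) \<partial>M) < ennreal (e / 2)) sequentially"
    using \<open>0 < e / 2\<close> by (intro order_tendstoD(2)) auto
  then obtain i where "(\<integral>\<^sup>+x. norm (f x - s i x) \<partial>M) < ennreal (e / 2)"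
    by (auto simp: eventually_sequentially)
  then have i: "mass UNIV (\<lambda>x. f x - s i x) \<le> ennreal (e / 2)"
    by (simp add: mass_UNIV)
  obtain u where u: "u \<in> Cc" "mass UNIV (\<lambda>x. s i x - u x) \<le> ennreal (e / 2)"
    using lim.IH[OF \<open>0 < e / 2\<close>] by blast
  have "mass UNIV (\<lambda>x. f x - u x) \<le> mass UNIV (\<lambda>x. f x - s i x) + mass UNIV (\<lambda>x. s i x - u x)"
    using lim.hyps(1,4) Cc_borel[OF u(1)] by (intro mass_triangle) auto
  also have "\<dots> \<le> ennreal (e / 2) + ennreal (e / 2)"
    using i u(2) by (rule add_mono)
  also have "\<dots> = ennreal e"
    using lim.prems by (simp flip: ennreal_plus)
  finally show ?case
    using u(1) by blast
qed

section \<open>Minkowski's inequality for a continuous kernel\<close>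

text \<open>
  The triangle inequality in \<open>L\<^sup>1(K)\<close> for the vector-valued integral of \<open>g(y) \<phi>(\<cdot>, y)\<close>. By
  compactness, \<open>L\<close> splits into finitely many Borel pieces \<open>B i\<close>, each with a point \<open>d i\<close> of \<open>L\<close>
  such that \<open>\<phi>(x, \<cdot>)\<close> differs from \<open>\<phi>(x, d i)\<close> by at most \<open>e\<close> on \<open>B i\<close>, uniformly in \<open>x \<in> K\<close>.
  This replaces the integral over \<open>y\<close> by a finite sum, which commutes with the integral over
  \<open>x\<close>, at a cost proportional to \<open>e\<close>.
\<close>

lemma mass_kernel_le:
  fixes \<phi> :: "'a \<Rightarrow> 'a \<Rightarrow> complex"
  assumes cont: "continuous_on UNIV (\<lambda>(y, x). \<phi> x y)"
    and K: "compact K" and L: "compact L"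
    and g: "integrable M g" "\<And>y. y \<notin> L \<Longrightarrow> g y = 0"
    and A: "\<And>y. y \<in> L \<Longrightarrow> mass K (\<lambda>x. \<phi> x y) \<le> A"
  shows "mass K (\<lambda>x. \<integral>y. g y * \<phi> x y \<partial>M) \<le> A * mass UNIV g"
proof (rule ennreal_le_scaled_epsilon)
  show "mass UNIV g * emeasure M K < \<infinity>"
    using g(1) emeasure_compact[OF K] by (simp add: integrable_iff_mass ennreal_mult_less_top)
  fix e :: real assume "0 < e"
  have [measurable]: "g \<in> borel_measurable M"
    using g(1) by auto
  have "\<exists>Y. y \<in> Y \<and> open Y \<and> (\<forall>t\<in>Y. \<forall>x\<in>K. dist (\<phi> x t) (\<phi> x y) \<le> e)" for y
  proof -
    obtain Y where "y \<in> Y" "open Y"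
        "\<forall>t\<in>Y \<inter> UNIV. \<forall>x\<in>K. dist ((\<lambda>(y, x). \<phi> x y) (t, x)) ((\<lambda>(y, x). \<phi> x y) (y, x)) \<le> e"
      using continuous_on_prod_compactE[OF continuous_on_subset[OF cont subset_UNIV] K UNIV_I \<open>0 < e\<close>]
      by blast
    then show ?thesis
      by auto
  qed
  then obtain Y where Y: "\<And>y. y \<in> Y y" "\<And>y. open (Y y)"
      "\<And>y t x. t \<in> Y y \<Longrightarrow> x \<in> K \<Longrightarrow> dist (\<phi> x t) (\<phi> x y) \<le> e"
    by metis
  have "L \<subseteq> (\<Union>y\<in>L. Y y)"
    using Y(1) by blast
  then obtain D where D: "D \<subseteq> L" "finite D" "L \<subseteq> (\<Union>y\<in>D. Y y)"
    by (rule compactE_image[OF L Y(2)])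
  obtain n :: nat and d where nd: "D = d ` {i. i < n}"
    using finite_imp_nat_seg_image_inj_on[OF D(2)] by blast
  \<comment> \<open>The neighbourhoods overlap; disjoint pieces are needed so that the masses of \<open>g\<close> add up.\<close>
  define B where "B i = L \<inter> disjointed (\<lambda>i. Y (d i)) i" for i
  have B_sets [measurable]: "B i \<in> sets M" for i
    using Y(2) compact_in_sets[OF L] unfolding B_def disjointed_def
    by (intro sets.Int sets.Diff sets.finite_UN) auto
  have B_Y: "B i \<subseteq> Y (d i)" for i
    using disjointed_subset[of "\<lambda>i. Y (d i)" i] by (auto simp: B_def)
  have "{i. i < n} = {0..<n}"
    by auto
  then have "L \<subseteq> (\<Union>i\<in>{0..<n}. Y (d i))"
    using D(3) by (simp add: nd)
  then have L_B: "L = (\<Union>i\<in>{..<n}. B i)"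
    unfolding B_def Int_UN_distrib[symmetric] lessThan_atLeast0 finite_UN_disjointed_eq by blast
  have B_disj: "disjoint_family_on B {..<n}"
    using disjoint_family_disjointed[of "\<lambda>i. Y (d i)"]
    by (auto simp: B_def disjoint_family_on_def)
  have dL: "d i \<in> L" if "i < n" for i
    using that D(1) nd by blast
  have split: "(\<Sum>i<n. ennreal (norm (g y)) * indicator (B i) y) = ennreal (norm (g y))" for y
  proof -
    have "(\<Sum>i<n. ennreal (norm (g y)) * indicator (B i) y) = ennreal (norm (g y)) * indicator L y"
      by (simp add: L_B indicator_UN_disjoint[OF _ B_disj] sum_distrib_left)
    then show ?thesis
      using g(2)[of y] by (cases "y \<in> L") auto
  qed
  have pt: "ennreal (norm (\<integral>y. g y * \<phi> x y \<partial>M)) \<le> (\<Sum>i<n. mass (B i) g * (ennreal (norm (\<phi> x (d i))) + ennreal e))"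
    if "x \<in> K" for x
  proof -
    have "ennreal (norm (\<integral>y. g y * \<phi> x y \<partial>M)) \<le> (\<integral>\<^sup>+y. ennreal (norm (g y * \<phi> x y)) \<partial>M)"
      by (cases "integrable M (\<lambda>y. g y * \<phi> x y)")
        (auto simp: integral_norm_bound_ennreal not_integrable_integral_eq)
    also have "\<dots> \<le> (\<integral>\<^sup>+y. (\<Sum>i<n. (ennreal (norm (g y)) * indicator (B i) y)
        * (ennreal (norm (\<phi> x (d i))) + ennreal e)) \<partial>M)"
    proof (rule nn_integral_mono)
      fix y
      have "ennreal (norm (g y)) * indicator (B i) y * ennreal (norm (\<phi> x y))
          \<le> ennreal (norm (g y)) * indicator (B i) y * (ennreal (norm (\<phi> x (d i))) + ennreal e)" for i
      proof (cases "y \<in> B i")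
        case True
        then have "dist (\<phi> x y) (\<phi> x (d i)) \<le> e"
          using Y(3) B_Y \<open>x \<in> K\<close> by blast
        then have "norm (\<phi> x y) \<le> norm (\<phi> x (d i)) + e"
          using norm_triangle_sub[of "\<phi> x y" "\<phi> x (d i)"] by (simp add: dist_norm)
        then have "ennreal (norm (\<phi> x y)) \<le> ennreal (norm (\<phi> x (d i))) + ennreal e"
          using \<open>0 < e\<close> by (simp flip: ennreal_plus add: ennreal_leI)
        then show ?thesis
          by (rule mult_left_mono) simp
      qed simp
      then have "(\<Sum>i<n. ennreal (norm (g y)) * indicator (B i) y * ennreal (norm (\<phi> x y)))
          \<le> (\<Sum>i<n. ennreal (norm (g y)) * indicator (B i) y * (ennreal (norm (\<phi> x (d i))) + ennreal e))"
        by (intro sum_mono)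
      then show "ennreal (norm (g y * \<phi> x y))
          \<le> (\<Sum>i<n. (ennreal (norm (g y)) * indicator (B i) y) * (ennreal (norm (\<phi> x (d i))) + ennreal e))"
        by (simp add: split norm_mult ennreal_mult flip: sum_distrib_right)
    qed
    also have "\<dots> = (\<Sum>i<n. mass (B i) g * (ennreal (norm (\<phi> x (d i))) + ennreal e))"
      unfolding mass_def by (simp add: nn_integral_sum nn_integral_multc)
    finally show ?thesis .
  qed
  have [measurable]: "(\<lambda>x. \<phi> x y) \<in> borel_measurable M" for y
  proof (rule borel_measurable_continuous)
    have "continuous_on UNIV (\<lambda>x. (\<lambda>(y, x). \<phi> x y) (y, x))"
      by (rule continuous_on_compose2[OF cont]) (auto intro!: continuous_intros)
    then show "continuous_on UNIV (\<lambda>x. \<phi> x y)"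
      by simp
  qed
  have [measurable]: "K \<in> sets M"
    by (rule compact_in_sets[OF K])
  have "mass K (\<lambda>x. \<integral>y. g y * \<phi> x y \<partial>M)
      \<le> (\<integral>\<^sup>+x. (\<Sum>i<n. mass (B i) g * (ennreal (norm (\<phi> x (d i))) * indicator K x + ennreal e * indicator K x)) \<partial>M)"
    unfolding mass_def[of K]
  proof (rule nn_integral_mono)
    fix x
    show "ennreal (norm (\<integral>y. g y * \<phi> x y \<partial>M)) * indicator K x
      \<le> (\<Sum>i<n. mass (B i) g * (ennreal (norm (\<phi> x (d i))) * indicator K x + ennreal e * indicator K x))"
      using pt[of x] by (cases "x \<in> K") auto
  qed
  also have "\<dots> = (\<Sum>i<n. mass (B i) g * (mass K (\<lambda>x. \<phi> x (d i)) + ennreal e * emeasure M K))"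
    unfolding mass_def[of K]
    using borel_compact[OF K] by (simp add: nn_integral_sum nn_integral_cmult nn_integral_add)
  also have "\<dots> \<le> (\<Sum>i<n. mass (B i) g * (A + ennreal e * emeasure M K))"
    using A dL by (intro sum_mono mult_left_mono add_right_mono) auto
  also have "\<dots> = (\<Sum>i<n. mass (B i) g) * (A + ennreal e * emeasure M K)"
    by (simp add: sum_distrib_right)
  also have "(\<Sum>i<n. mass (B i) g) = mass UNIV g"
    unfolding mass_def by (subst nn_integral_sum[symmetric]) (auto simp: split)
  finally show "mass K (\<lambda>x. \<integral>y. g y * \<phi> x y \<partial>M)
      \<le> A * mass UNIV g + mass UNIV g * emeasure M K * ennreal e"
    by (simp add: algebra_simps)
qed

section \<open>Convolution with continuous functions of compact support\<close>

definition locally_integrable :: "('a \<Rightarrow> complex) \<Rightarrow> bool" where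
  "locally_integrable k \<longleftrightarrow> k \<in> borel_measurable M \<and> (\<forall>L. compact L \<longrightarrow> mass L k < \<infinity>)"

lemma locally_integrable_measurable: "locally_integrable k \<Longrightarrow> k \<in> borel_measurable M"
  by (simp add: locally_integrable_def)

lemma locally_integrable_mass: "locally_integrable k \<Longrightarrow> compact L \<Longrightarrow> mass L k < \<infinity>"
  by (simp add: locally_integrable_def)

lemma integrable_imp_locally_integrable: "integrable M g \<Longrightarrow> locally_integrable g"
  using mass_mono_set[OF subset_UNIV, of _ g]
  by (auto simp: locally_integrable_def integrable_iff_mass intro: order_le_less_trans)

lemma locally_integrable_cut:
  assumes "locally_integrable k" "compact L"
  shows "integrable M (\<lambda>y. indicator L y * k y)"
proof -
  have "(\<lambda>y. indicator L y * k y) \<in> borel_measurable M"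
    using locally_integrable_measurable[OF assms(1)] compact_in_sets[OF assms(2)]
    by (intro borel_measurable_times borel_measurable_indicator)
  then show ?thesis
    using locally_integrable_mass[OF assms] by (simp add: integrable_iff_mass mass_indicator)
qed

text \<open>
  For \<open>x\<close> in \<open>K\<close> and \<open>f\<close> supported in \<open>S\<close>, the integrand \<open>k(y) f(- y + x)\<close> depends on \<open>k\<close> only
  through its values on the set \<open>K - S\<close>, which is compact if \<open>K\<close> and \<open>S\<close> are.
\<close>

lemma reflect_in_support:
  fixes x y :: 'a
  assumes "- y + x \<in> S" "x \<in> K"
  shows "y \<in> (\<lambda>(x, z). x - z) ` (K \<times> S)"
proof -
  have "y = x - (- y + x)"
    by (simp only: diff_conv_add_uminus minus_add minus_minus add.assoc[symmetric]) simp
  then show ?thesis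
    using assms by (intro image_eqI[of _ _ "(x, - y + x)"]) auto
qed

lemma convolution_integrable:
  assumes "locally_integrable k" "f \<in> Cc"
  shows "integrable M (\<lambda>y. k y * f (- y + x))"
proof -
  obtain S where S: "compact S" "\<And>x. x \<notin> S \<Longrightarrow> f x = 0"
    using Cc_supportE[OF assms(2)] by blast
  obtain B where B: "0 \<le> B" "\<And>x. norm (f x) \<le> B"
    using Cc_boundedE[OF assms(2)] by blast
  define L where "L = (\<lambda>(x, z). x - z) ` ({x} \<times> S)"
  have L: "compact L"
    unfolding L_def by (intro compact_diff_image S(1)) simp
  have f': "(\<lambda>y. f (- y + x)) \<in> borel_measurable M"
    by (intro borel_measurable_continuous continuous_on_compose2[OF Cc_continuous[OF assms(2)]]
        continuous_intros) auto
  have "mass UNIV (\<lambda>y. k y * f (- y + x)) \<le> mass UNIV (\<lambda>y. complex_of_real B * (indicator L y * k y))"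
  proof (rule mass_mono)
    fix y
    show "norm (k y * f (- y + x)) \<le> norm (complex_of_real B * (indicator L y * k y))"
    proof (cases "- y + x \<in> S")
      case True
      then have "y \<in> L"
        unfolding L_def by (rule reflect_in_support) simp
      then show ?thesis
        using B mult_left_mono[OF B(2)[of "- y + x"], of "norm (k y)"]
        by (simp add: norm_mult mult.commute)
    qed (simp add: S(2))
  qed
  also have "\<dots> < \<infinity>"
    using integrable_mult_right[OF locally_integrable_cut[OF assms(1) L], of "complex_of_real B"]
    unfolding integrable_iff_mass by (rule conjunct2)
  finally show ?thesis
    using f' locally_integrable_measurable[OF assms(1)]
    by (simp add: integrable_iff_mass borel_measurable_times)
qed

text \<open>
  Near \<open>x0\<close> the integrands live on one compact set \<open>L\<close>, and \<open>f(- y + x)\<close> tends to \<open>f(- y + x0)\<close>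
  uniformly in \<open>y \<in> L\<close>. Continuity is used for the measurability of \<open>k * f\<close>.
\<close>

lemma convolution_continuous:
  assumes "locally_integrable k" "f \<in> Cc"
  shows "continuous_on UNIV (convolution M k f)"
  unfolding continuous_on_def tendsto_iff eventually_at_topological
proof (intro ballI allI impI)
  fix x0 :: 'a and r :: real assume "0 < r"
  obtain S where S: "compact S" "\<And>x. x \<notin> S \<Longrightarrow> f x = 0"
    using Cc_supportE[OF assms(2)] by blast
  obtain U W where UW: "open U" "compact W" "x0 \<in> U" "U \<subseteq> W" "W \<subseteq> UNIV"
    by (rule compact_nbhd_inside[OF locally_compact open_UNIV UNIV_I])
  define L where "L = (\<lambda>(x, z). x - z) ` (W \<times> S)"
  have L: "compact L"
    unfolding L_def by (intro compact_diff_image S(1) UW(2))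
  define m where "m = enn2real (mass L k)"
  have m: "mass L k = ennreal m" "0 \<le> m"
    using locally_integrable_mass[OF assms(1) L] by (simp_all add: m_def less_top)
  define e where "e = r / (m + 1)"
  have "0 < e"
    using \<open>0 < r\<close> m(2) by (simp add: e_def)
  have em: "e * m < r"
    using \<open>0 < r\<close> m(2) by (simp add: e_def divide_less_eq algebra_simps)
  have cont: "continuous_on (UNIV \<times> L) (\<lambda>(x, y). f (- y + x))"
    unfolding case_prod_unfold
    by (intro continuous_on_compose2[OF Cc_continuous[OF assms(2)]] continuous_intros) auto
  obtain X where X: "x0 \<in> X" "open X"
      "\<forall>x\<in>X \<inter> UNIV. \<forall>t\<in>L. dist ((\<lambda>(x, y). f (- y + x)) (x, t)) ((\<lambda>(x, y). f (- y + x)) (x0, t)) \<le> e"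
    by (rule continuous_on_prod_compactE[OF cont L UNIV_I \<open>0 < e\<close>])
  have "dist (convolution M k f x) (convolution M k f x0) < r" if x: "x \<in> X \<inter> U" for x
  proof -
    have "ennreal (dist (convolution M k f x) (convolution M k f x0))
        = ennreal (norm (\<integral>y. k y * f (- y + x) - k y * f (- y + x0) \<partial>M))"
      using convolution_integrable[OF assms]
      by (simp add: convolution_def dist_norm Bochner_Integration.integral_diff)
    also have "\<dots> \<le> (\<integral>\<^sup>+y. ennreal (norm (k y * f (- y + x) - k y * f (- y + x0))) \<partial>M)"
      by (intro integral_norm_bound_ennreal Bochner_Integration.integrable_diff
          convolution_integrable[OF assms])
    also have "\<dots> \<le> (\<integral>\<^sup>+y. ennreal (norm (complex_of_real e * (indicator L y * k y))) \<partial>M)"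
    proof (intro nn_integral_mono ennreal_leI)
      fix y
      have eq: "norm (k y * f (- y + x) - k y * f (- y + x0))
          = norm (k y) * dist (f (- y + x)) (f (- y + x0))"
        by (simp add: dist_norm norm_mult flip: right_diff_distrib)
      show "norm (k y * f (- y + x) - k y * f (- y + x0))
          \<le> norm (complex_of_real e * (indicator L y * k y))"
      proof (cases "y \<in> L")
        case True
        then have "dist (f (- y + x)) (f (- y + x0)) \<le> e"
          using X(3) x by auto
        then have "norm (k y) * dist (f (- y + x)) (f (- y + x0)) \<le> norm (k y) * e"
          by (rule mult_left_mono) simp
        then show ?thesis
          using True \<open>0 < e\<close> eq by (simp add: norm_mult mult.commute)
      next
        case False
        have "- y + x \<notin> S" "- y + x0 \<notin> S"
          using False x UW reflect_in_support[of y _ S W] unfolding L_def by blast+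
        then show ?thesis
          by (simp add: S(2))
      qed
    qed
    also have "\<dots> = mass UNIV (\<lambda>y. complex_of_real e * (indicator L y * k y))"
      by (simp add: mass_UNIV)
    also have "\<dots> = ennreal (norm (complex_of_real e)) * mass UNIV (\<lambda>y. indicator L y * k y)"
      using locally_integrable_cut[OF assms(1) L] by (intro mass_cmult) auto
    also have "\<dots> = ennreal (e * m)"
      using \<open>0 < e\<close> m by (simp add: mass_indicator ennreal_mult)
    finally have "dist (convolution M k f x) (convolution M k f x0) \<le> e * m"
      using \<open>0 < e\<close> m(2) by (simp add: ennreal_le_iff)
    with em show ?thesis
      by simp
  qed
  then show "\<exists>T. open T \<and> x0 \<in> T \<and> (\<forall>x\<in>T. x \<noteq> x0 \<longrightarrow> x \<in> UNIV \<longrightarrow>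
      dist (convolution M k f x) (convolution M k f x0) < r)"
    using X(1,2) UW(1,3) by (intro exI[of _ "X \<inter> U"]) auto
qed

lemma convolution_borel:
  "locally_integrable k \<Longrightarrow> f \<in> Cc \<Longrightarrow> convolution M k f \<in> borel_measurable M"
  by (intro borel_measurable_continuous convolution_continuous)

lemma convolution_diff_right:
  assumes "locally_integrable k" "f \<in> Cc" "g \<in> Cc"
  shows "convolution M k (\<lambda>z. f z - g z) x = convolution M k f x - convolution M k g x"
  using convolution_integrable[OF assms(1,2)] convolution_integrable[OF assms(1,3)]
  by (simp add: convolution_def right_diff_distrib)

lemma convolution_add_right:
  assumes "locally_integrable k" "f \<in> Cc" "g \<in> Cc"
  shows "convolution M k (\<lambda>z. f z + g z) x = convolution M k f x + convolution M k g x"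
  using convolution_integrable[OF assms(1,2)] convolution_integrable[OF assms(1,3)]
  by (simp add: convolution_def distrib_left)

lemma convolution_cmult_right:
  "convolution M k (\<lambda>z. c * f z) x = c * convolution M k f x"
proof -
  have "(\<lambda>y. k y * (c * f (- y + x))) = (\<lambda>y. c * (k y * f (- y + x)))"
    by (simp add: ac_simps)
  then show ?thesis
    by (simp add: convolution_def)
qed

lemma convolution_swap:
  assumes "h \<in> Cc" "f \<in> Cc"
  shows "convolution M h f x = (\<integral>z. f z * h (x - z) \<partial>M)"
proof -
  have "continuous_on UNIV (\<lambda>z. f z * h (x - z))"
    by (intro continuous_intros continuous_on_compose2[OF Cc_continuous[OF assms(1)]]
        Cc_continuous[OF assms(2)]) auto
  then have "(\<integral>y. f (- y + x) * h (x - (- y + x)) \<partial>M) = (\<integral>z. f z * h (x - z) \<partial>M)"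
    by (intro integral_invariant[OF distr_reflect] borel_measurable_continuous)
      (intro continuous_intros)
  moreover have "x - (- y + x) = y" for y
    by (simp only: diff_conv_add_uminus minus_add minus_minus add.assoc[symmetric]) simp
  ultimately show ?thesis
    by (simp add: convolution_def mult.commute)
qed

text \<open>
  Minkowski's inequality with \<open>\<phi>(x, y) = f(- y + x)\<close>, whose mass is at most \<open>\<parallel>f\<parallel>\<^sub>1\<close> by left
  invariance. It makes errors of \<open>L\<^sup>1\<close> type in the kernel harmless.
\<close>

lemma mass_convolution_L1:
  assumes g: "integrable M g" and L: "compact L" "\<And>y. y \<notin> L \<Longrightarrow> g y = 0"
    and f: "f \<in> Cc" and K: "compact K"
  shows "mass K (convolution M g f) \<le> mass UNIV f * mass UNIV g"
  unfolding convolution_def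
proof (rule mass_kernel_le[OF _ K L(1) g L(2)])
  show "continuous_on UNIV (\<lambda>(y, x). f (- y + x))"
    unfolding case_prod_unfold
    by (intro continuous_on_compose2[OF Cc_continuous[OF f]] continuous_intros) auto
  fix y
  have "mass K (\<lambda>x. f (- y + x)) \<le> mass UNIV (\<lambda>x. f (- y + x))"
    by (rule mass_mono_set) simp
  also have "\<dots> = mass UNIV f"
    unfolding mass_UNIV
    using Cc_borel[OF f] by (intro nn_integral_invariant distr_translate_left continuous_intros) auto
  finally show "mass K (\<lambda>x. f (- y + x)) \<le> mass UNIV f" .
qed

text \<open>
  Minkowski's inequality with \<open>\<phi>(x, z) = h(x - z)\<close>: here the translates of the kernel are
  averaged with weight \<open>f\<close>, whence the restriction to continuous \<open>h\<close>.
\<close>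

lemma mass_convolution_Cc:
  assumes "h \<in> Cc" "f \<in> Cc" "compact S" "\<And>z. z \<notin> S \<Longrightarrow> f z = 0" "compact K"
    and A: "\<And>z. z \<in> S \<Longrightarrow> mass K (\<lambda>x. h (x - z)) \<le> A"
  shows "mass K (convolution M h f) \<le> A * mass UNIV f"
  unfolding convolution_swap[OF assms(1,2)]
proof (rule mass_kernel_le[OF _ assms(5,3) Cc_integrable[OF assms(2)] assms(4) A])
  show "continuous_on UNIV (\<lambda>(y, x). h (x - y))"
    unfolding case_prod_unfold
    by (intro continuous_on_compose2[OF Cc_continuous[OF assms(1)]] continuous_intros) auto
qed

lemma mass_translate:
  assumes "g \<in> borel_measurable M" "compact K"
  shows "mass K (\<lambda>x. g (x - z)) = mass ((\<lambda>x. x - z) ` K) g"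
proof -
  let ?K = "(\<lambda>x. x - z) ` K"
  have "compact ?K"
    by (intro compact_continuous_image assms(2) continuous_intros)
  then have meas: "(\<lambda>x. ennreal (norm (g x)) * indicator ?K x) \<in> borel_measurable M"
    using assms(1) compact_in_sets[of ?K] by measurable
  have "mass K (\<lambda>x. g (x - z)) = (\<integral>\<^sup>+x. ennreal (norm (g (x + - z))) * indicator ?K (x + - z) \<partial>M)"
  proof -
    have "x + - z \<in> ?K \<longleftrightarrow> x \<in> K" for x
      by (auto simp: image_iff) (metis diff_add_cancel)
    then show ?thesis
      unfolding mass_def by (intro nn_integral_cong) (simp add: indicator_def)
  qed
  also have "\<dots> = mass ?K g"
    unfolding mass_def
    by (intro nn_integral_invariant[OF distr_translate_right _ meas] continuous_intros)
  finally show ?thesis .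
qed

lemma emeasure_translate:
  assumes "compact K"
  shows "emeasure M ((\<lambda>x. x - z) ` K) = emeasure M K"
proof -
  have "compact ((\<lambda>x. x - z) ` K)"
    by (intro compact_continuous_image assms continuous_intros)
  then show ?thesis
    using mass_translate[of "\<lambda>_. 1" K z] assms by (simp add: mass_def borel_compact)
qed

lemma Cc_approx_on_compactE:
  assumes "locally_integrable k" "compact L" "0 < (e :: real)"
  obtains h where "h \<in> Cc" "mass UNIV (\<lambda>y. indicator L y * k y - h y) \<le> ennreal e"
  using Cc_dense_L1[OF locally_integrable_cut[OF assms(1,2)] assms(3)] by blast

text \<open>
  On \<open>K\<close> only the values of the kernel on \<open>L\<close> matter, so \<open>k - h\<close> may be cut off to \<open>L\<close> and
  treated as an integrable kernel.
\<close>

lemma mass_convolution_approx: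
  assumes k: "locally_integrable k" and h: "h \<in> Cc" and f: "f \<in> Cc" and K: "compact K"
    and S: "compact S" "\<And>z. z \<notin> S \<Longrightarrow> f z = 0"
    and L: "compact L" "(\<lambda>(x, z). x - z) ` (K \<times> S) \<subseteq> L"
    and e: "mass UNIV (\<lambda>y. indicator L y * k y - h y) \<le> e"
  shows "mass K (\<lambda>x. convolution M k f x - convolution M h f x) \<le> mass UNIV f * e"
proof -
  let ?g = "\<lambda>y. indicator L y * (k y - h y)"
  have eq: "?g = (\<lambda>y. indicator L y * k y - indicator L y * h y)"
    by (simp add: right_diff_distrib)
  have g: "integrable M ?g"
    unfolding eq using k integrable_imp_locally_integrable[OF Cc_integrable[OF h]]
    by (intro Bochner_Integration.integrable_diff locally_integrable_cut L(1))
  have "convolution M k f x - convolution M h f x = convolution M ?g f x" if "x \<in> K" for x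
  proof -
    have "convolution M k f x - convolution M h f x
        = (\<integral>y. k y * f (- y + x) - h y * f (- y + x) \<partial>M)"
      unfolding convolution_def
      by (intro Bochner_Integration.integral_diff[symmetric] convolution_integrable[OF _ f]
          k integrable_imp_locally_integrable[OF Cc_integrable[OF h]])
    also have "\<dots> = convolution M ?g f x"
      unfolding convolution_def
    proof (rule Bochner_Integration.integral_cong[OF refl])
      fix y
      show "k y * f (- y + x) - h y * f (- y + x) = ?g y * f (- y + x)"
      proof (cases "y \<in> L")
        case False
        then have "- y + x \<notin> S"
          using reflect_in_support[of y x S K] that L(2) by blast
        then show ?thesis
          by (simp add: S(2))
      qed (simp add: left_diff_distrib)
    qed
    finally show ?thesis .
  qed
  then have "mass K (\<lambda>x. convolution M k f x - convolution M h f x) = mass K (convolution M ?g f)"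
    by (rule mass_cong)
  also have "\<dots> \<le> mass UNIV f * mass UNIV ?g"
    by (rule mass_convolution_L1[OF g L(1) _ f K]) simp
  also have "\<dots> \<le> mass UNIV f * e"
  proof (rule mult_left_mono)
    have "mass UNIV ?g \<le> mass UNIV (\<lambda>y. indicator L y * k y - h y)"
      by (rule mass_mono) (auto simp: indicator_def)
    then show "mass UNIV ?g \<le> e"
      using e by (rule order_trans)
  qed simp
  finally show ?thesis .
qed

section \<open>The weak norm and mean bounds\<close>

text \<open>
  The least such \<open>c\<close> is, up to a factor that depends only on \<open>p\<close>, the weak \<open>L\<^sup>p\<close> norm of \<open>g\<close> when
  \<open>p > 1\<close>, but the condition is stable under sums and averages with the right constants. For
  null \<open>K\<close> the convention \<open>0 powr (1 - 1 / p) = 0\<close> is the correct value.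
\<close>

definition mean_bound :: "real \<Rightarrow> ennreal \<Rightarrow> ('a \<Rightarrow> complex) \<Rightarrow> bool" where
  "mean_bound p c g \<longleftrightarrow>
     (\<forall>K. compact K \<longrightarrow> mass K g \<le> c * ennreal (measure M K powr (1 - 1 / p)))"

lemma mean_boundD:
  "mean_bound p c g \<Longrightarrow> compact K \<Longrightarrow> mass K g \<le> c * ennreal (measure M K powr (1 - 1 / p))"
  by (simp add: mean_bound_def)

lemma mean_bound_mono: "mean_bound p c g \<Longrightarrow> c \<le> d \<Longrightarrow> mean_bound p d g"
  unfolding mean_bound_def by (meson mult_right_mono order_trans zero_le)

lemma mean_bound_add:
  assumes "mean_bound p c g" "mean_bound p d h" "g \<in> borel_measurable M" "h \<in> borel_measurable M"
  shows "mean_bound p (c + d) (\<lambda>x. g x + h x)"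
  unfolding mean_bound_def
proof (intro allI impI)
  fix K :: "'a set" assume K: "compact K"
  have "mass K (\<lambda>x. g x + h x) \<le> mass K g + mass K h"
    by (intro mass_add assms compact_in_sets K)
  also have "\<dots> \<le> (c + d) * ennreal (measure M K powr (1 - 1 / p))"
    unfolding distrib_right by (intro add_mono mean_boundD assms K)
  finally show "mass K (\<lambda>x. g x + h x) \<le> (c + d) * ennreal (measure M K powr (1 - 1 / p))" .
qed

lemma mean_bound_cmult:
  assumes "mean_bound p c g" "g \<in> borel_measurable M"
  shows "mean_bound p (ennreal (norm a) * c) (\<lambda>x. a * g x)"
  unfolding mean_bound_def
proof (intro allI impI)
  fix K :: "'a set" assume K: "compact K"
  show "mass K (\<lambda>x. a * g x) \<le> ennreal (norm a) * c * ennreal (measure M K powr (1 - 1 / p))"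
    using mult_left_mono[OF mean_boundD[OF assms(1) K], of "ennreal (norm a)"]
    by (simp add: mass_cmult[OF assms(2) compact_in_sets[OF K]] mult.assoc)
qed

lemma mean_bound_imp_locally_integrable:
  assumes "k \<in> borel_measurable M" "mean_bound p c k" "c < \<infinity>"
  shows "locally_integrable k"
  unfolding locally_integrable_def
proof (intro conjI allI impI assms(1))
  fix K :: "'a set" assume "compact K"
  have "c * ennreal (measure M K powr (1 - 1 / p)) < \<infinity>"
    using assms(3) by (simp add: ennreal_mult_less_top)
  then show "mass K k < \<infinity>"
    by (rule order_le_less_trans[OF mean_boundD[OF assms(2) \<open>compact K\<close>]])
qed

text \<open>
  This identifies values of the extended operator. The mean bounds of \<open>g - w\<close> and \<open>h - w\<close> add
  up, so the integral of \<open>\<bar>g - h\<bar>\<close> over every compact set is arbitrarily small.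
\<close>

lemma AE_eq_if_close_to_common:
  assumes "g \<in> borel_measurable M" "h \<in> borel_measurable M" "c < \<infinity>"
    and close: "\<And>e::real. 0 < e \<Longrightarrow> \<exists>w\<in>borel_measurable M.
      mean_bound p (c * ennreal e) (\<lambda>x. g x - w x) \<and> mean_bound p (c * ennreal e) (\<lambda>x. h x - w x)"
  shows "AE x in M. g x = h x"
proof (rule AE_eq_if_mass_zero[OF assms(1,2)])
  fix K :: "'a set" assume K: "compact K"
  define b where "b = ennreal (measure M K powr (1 - 1 / p))"
  have "mass K (\<lambda>x. g x - h x) \<le> 0"
  proof (rule ennreal_le_scaled_epsilon)
    show "2 * c * b < \<infinity>"
      using assms(3) by (simp add: b_def ennreal_mult_less_top)
    fix e :: real assume "0 < e"
    obtain w where w: "w \<in> borel_measurable M" "mean_bound p (c * ennreal e) (\<lambda>x. g x - w x)"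
        "mean_bound p (c * ennreal e) (\<lambda>x. h x - w x)"
      using close[OF \<open>0 < e\<close>] by blast
    have "mass K (\<lambda>x. g x - h x) \<le> mass K (\<lambda>x. g x - w x) + mass K (\<lambda>x. w x - h x)"
      by (intro mass_triangle assms(1,2) w(1) compact_in_sets K)
    also have "\<dots> \<le> c * ennreal e * b + c * ennreal e * b"
      using mean_boundD[OF w(2) K] mean_boundD[OF w(3) K]
      by (intro add_mono) (simp_all add: b_def mass_minus_commute[of K w h])
    also have "\<dots> = 0 + 2 * c * b * ennreal e"
      by (simp add: mult_2 distrib_right mult.assoc mult.commute[of b])
    finally show "mass K (\<lambda>x. g x - h x) \<le> 0 + 2 * c * b * ennreal e" .
  qed
  then show "mass K (\<lambda>x. g x - h x) = 0"
    by simp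
qed

text \<open>
  Chebyshev's inequality on compact subsets \<open>K\<close> of the level set gives \<open>\<alpha> \<mu>(K) \<le> c \<mu>(K)\<^bsup>1-1/p\<^esup>\<close>,
  that is \<open>\<mu>(K) \<le> (c / \<alpha>)\<^sup>p\<close>; inner regularity extends this to the level set.
\<close>

lemma weak_Lp_norm_le_if_mean_bound:
  assumes "g \<in> borel_measurable M" "0 \<le> c" "mean_bound p (ennreal c) g" "1 < p"
  shows "weak_Lp_norm M p g \<le> ennreal c"
  unfolding weak_Lp_norm_def
proof (rule SUP_least)
  fix \<alpha> :: real assume "\<alpha> \<in> {0<..}"
  then have "0 < \<alpha>"
    by simp
  define E where "E = {s \<in> space M. norm (g s) > \<alpha>}"
  have E: "E \<in> sets M"
    unfolding E_def using assms(1) by measurable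
  have "emeasure M E \<le> ennreal ((c / \<alpha>) powr p)"
    unfolding inner_regular[OF E]
  proof (rule SUP_least)
    fix K assume "K \<in> {K. compact K \<and> K \<subseteq> E}"
    then have K: "compact K" "K \<subseteq> E"
      by auto
    define m where "m = measure M K"
    have "ennreal (\<alpha> * m) = (\<integral>\<^sup>+x. ennreal \<alpha> * indicator K x \<partial>M)"
      using compact_in_sets[OF K(1)] emeasure_compact_eq[OF K(1)] \<open>0 < \<alpha>\<close>
      by (simp add: nn_integral_cmult_indicator ennreal_mult m_def del: sets_M)
    also have "\<dots> \<le> mass K g"
      unfolding mass_def
      using K(2) by (intro nn_integral_mono) (auto simp: E_def indicator_def intro!: ennreal_leI)
    also have "\<dots> \<le> ennreal (c * m powr (1 - 1 / p))"
      using mean_boundD[OF assms(3) K(1)] assms(2) by (simp add: ennreal_mult m_def)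
    finally have le: "\<alpha> * m \<le> c * m powr (1 - 1 / p)"
      using assms(2) by (simp add: ennreal_le_iff)
    have "m \<le> (c / \<alpha>) powr p"
    proof (cases "m = 0")
      case False
      then have "0 < m"
        by (simp add: m_def less_le)
      have "m powr (1 - 1 / p) * m powr (1 / p) = m"
        using \<open>0 < m\<close> by (simp flip: powr_add)
      then have "\<alpha> * m powr (1 / p) * m powr (1 - 1 / p) \<le> c * m powr (1 - 1 / p)"
        using le by (simp add: ac_simps)
      then have "\<alpha> * m powr (1 / p) \<le> c"
        using \<open>0 < m\<close> by simp
      then have "m powr (1 / p) \<le> c / \<alpha>"
        using \<open>0 < \<alpha>\<close> by (simp add: field_simps)
      then have "(m powr (1 / p)) powr p \<le> (c / \<alpha>) powr p"
        using assms(4) by (intro powr_mono2) auto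
      then show ?thesis
        using \<open>0 < m\<close> assms(4) by (simp add: powr_powr)
    qed simp
    then show "emeasure M K \<le> ennreal ((c / \<alpha>) powr p)"
      unfolding emeasure_compact_eq[OF K(1)] m_def by (rule ennreal_leI)
  qed
  then obtain m where m: "emeasure M E = ennreal m" "0 \<le> m" "m \<le> (c / \<alpha>) powr p"
    by (cases "emeasure M E" rule: ennreal_cases) (auto simp: ennreal_le_iff top_unique)
  have "m powr (1 / p) \<le> ((c / \<alpha>) powr p) powr (1 / p)"
    using m assms(4) by (intro powr_mono2) auto
  also have "\<dots> = c / \<alpha>"
    using assms(2,4) \<open>0 < \<alpha>\<close> by (simp add: powr_powr)
  finally have "\<alpha> * m powr (1 / p) \<le> c"
    using \<open>0 < \<alpha>\<close> by (simp add: field_simps)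
  then have "ennreal \<alpha> * ennreal (m powr (1 / p)) \<le> ennreal c"
    using \<open>0 < \<alpha>\<close> by (simp add: ennreal_leI flip: ennreal_mult)
  then show "ennreal \<alpha> * ennreal_rpow (emeasure M {s \<in> space M. norm (g s) > \<alpha>}) (1 / p) \<le> ennreal c"
    unfolding E_def[symmetric] m(1) ennreal_rpow_def using m(2) by simp
qed

lemma distribution_le_if_weak_Lp_norm:
  assumes "weak_Lp_norm M p g \<le> ennreal A" "0 \<le> A" "1 < p" "0 < t"
  shows "emeasure M {x. norm (g x) > t} \<le> ennreal ((A / t) powr p)"
proof -
  have "ennreal t * ennreal_rpow (emeasure M {s \<in> space M. norm (g s) > t}) (1 / p) \<le> weak_Lp_norm M p g"
    unfolding weak_Lp_norm_def by (rule SUP_upper) (use assms(4) in simp)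
  then have le: "ennreal t * ennreal_rpow (emeasure M {x. norm (g x) > t}) (1 / p) \<le> ennreal A"
    using assms(1) by simp
  show ?thesis
  proof (cases "emeasure M {x. norm (g x) > t}" rule: ennreal_cases)
    case top
    with le assms(4) show ?thesis
      by (simp add: ennreal_rpow_def ennreal_mult_top top_unique)
  next
    case (real m)
    then have "ennreal (t * m powr (1 / p)) \<le> ennreal A"
      using le assms(4) by (simp add: ennreal_rpow_def ennreal_mult)
    then have "m powr (1 / p) \<le> A / t"
      using assms(2,4) by (simp add: ennreal_le_iff field_simps)
    then have "(m powr (1 / p)) powr p \<le> (A / t) powr p"
      using assms(3) by (intro powr_mono2) auto
    then have "m \<le> (A / t) powr p"
      using assms(3) real(1) by (simp add: powr_powr)
    then show ?thesis
      unfolding real(2) by (rule ennreal_leI)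
  qed
qed

text \<open>
  If \<open>r > s\<close>, then \<open>2\<^sup>n s < r \<le> 2\<^bsup>n+1\<^esup> s\<close> for some \<open>n\<close>, and the summand at this \<open>n\<close> alone is at
  least \<open>r\<close>.
\<close>

lemma le_dyadic_layers:
  fixes r s :: real
  assumes "0 < s"
  shows "ennreal r \<le> ennreal s + (\<Sum>n. ennreal (2 ^ (n + 1) * s) * indicator {x. x > 2 ^ n * s} r)"
proof (cases "r \<le> s")
  case True
  then show ?thesis
    by (rule order_trans[OF ennreal_leI]) simp
next
  case False
  obtain N where "r / s < 2 ^ N"
    using real_arch_pow[of 2 "r / s"] by auto
  then have ex: "\<exists>n. r \<le> 2 ^ n * s"
    using assms by (intro exI[of _ N]) (simp add: field_simps)
  define n where "n = (LEAST n. r \<le> 2 ^ n * s)"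
  have n: "r \<le> 2 ^ n * s"
    unfolding n_def by (rule LeastI_ex[OF ex])
  with False have "n \<noteq> 0"
    by (intro notI) simp
  then obtain j where j: "n = Suc j"
    by (cases n) auto
  have "\<not> r \<le> 2 ^ j * s"
    using not_less_Least[of j "\<lambda>n. r \<le> 2 ^ n * s"] j by (simp add: n_def)
  define t where "t n = ennreal (2 ^ (n + 1) * s) * indicator {x. x > 2 ^ n * s} r" for n
  have "ennreal r \<le> t j"
    using n j \<open>\<not> r \<le> 2 ^ j * s\<close> by (simp add: t_def ennreal_leI)
  also have "t j \<le> (\<Sum>n. t n)"
    using sum_le_suminf[of t "{j}"] by simp
  finally show ?thesis
    unfolding t_def by (rule order_trans) simp
qed

text \<open>
  The total \<open>1 + 2 \<Sum>\<^sub>n 2\<^bsup>n(1-p)\<^esup>\<close> of the dyadic layers in the next estimate; the series converges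
  because \<open>p > 1\<close>.
\<close>

definition layer_const :: "real \<Rightarrow> real" where
  "layer_const p = 1 + 2 / (1 - 2 powr (1 - p))"

lemma layer_const_pos: "1 < p \<Longrightarrow> 0 < layer_const p"
  using powr_less_mono[of "1 - p" 0 2] by (simp add: layer_const_def add_pos_pos)

text \<open>
  Below the level \<open>s\<close> the integral over \<open>K\<close> is at most \<open>s \<mu>(K)\<close>. The layer between \<open>2\<^sup>n s\<close> and
  \<open>2\<^bsup>n+1\<^esup> s\<close> contributes at most \<open>2\<^bsup>n+1\<^esup> s (A / (2\<^sup>n s))\<^sup>p\<close>, a geometric series in \<open>n\<close>. The level \<open>s =
  A \<mu>(K)\<^bsup>-1/p\<^esup>\<close> balances the two parts.
\<close>

lemma mean_bound_if_weak_Lp_norm: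
  assumes g: "g \<in> borel_measurable M" and weak: "weak_Lp_norm M p g \<le> ennreal A"
    and "0 < A" "1 < p"
  shows "mean_bound p (ennreal (A * layer_const p)) g"
  unfolding mean_bound_def
proof (intro allI impI)
  fix K :: "'a set" assume K: "compact K"
  define m where "m = measure M K"
  have mK: "emeasure M K = ennreal m"
    unfolding m_def by (rule emeasure_compact_eq[OF K])
  show "mass K g \<le> ennreal (A * layer_const p) * ennreal (measure M K powr (1 - 1 / p))"
  proof (cases "m = 0")
    case True
    then have "AE x in M. x \<notin> K"
      using mK compact_in_sets[OF K] by (intro AE_not_in null_setsI) auto
    then have "mass K g = (\<integral>\<^sup>+x. 0 \<partial>M)"
      unfolding mass_def by (intro nn_integral_cong_AE) (auto elim!: eventually_mono)
    then show ?thesis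
      by simp
  next
    case False
    then have "0 < m"
      by (simp add: m_def less_le)
    \<comment> \<open>This level satisfies \<open>(A / s)\<^sup>p = m\<close>.\<close>
    define s where "s = A * m powr (- 1 / p)"
    have "0 < s"
      using \<open>0 < A\<close> \<open>0 < m\<close> by (simp add: s_def)
    define q where "q = (2::real) powr (1 - p)"
    have q: "0 < q" "q < 1"
      using powr_less_mono[of "1 - p" 0 2] \<open>1 < p\<close> by (auto simp: q_def)
    have sm: "s * m = A * m powr (1 - 1 / p)"
      using \<open>0 < m\<close> by (simp add: s_def powr_diff powr_minus_divide)
    have As: "(A / s) powr p = m"
      using \<open>0 < A\<close> \<open>0 < m\<close> \<open>1 < p\<close> by (simp add: s_def powr_minus_divide powr_powr)
    have layer: "ennreal (2 ^ (n + 1) * s) * emeasure M {x. norm (g x) > 2 ^ n * s}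
        \<le> ennreal (2 * (s * m) * q ^ n)" for n
    proof -
      have "(A / (2 ^ n * s)) powr p = m * (2 ^ n) powr (- p)"
      proof -
        have "A / (2 ^ n * s) = (A / s) / 2 ^ n"
          by simp
        then have "(A / (2 ^ n * s)) powr p = (A / s) powr p / (2 ^ n) powr p"
          using \<open>0 < A\<close> \<open>0 < s\<close> by (simp only: powr_divide)
        then show ?thesis
          by (simp add: As powr_minus_divide)
      qed
      moreover have "2 ^ n * (2 ^ n) powr (- p) = q ^ n"
      proof -
        have "(2::real) ^ n * (2 ^ n) powr (- p) = (2 ^ n) powr 1 * (2 ^ n) powr (- p)"
          by simp
        also have "\<dots> = (2 ^ n) powr (1 - p)"
          by (subst powr_add[symmetric]) simp
        also have "\<dots> = q ^ n"
          by (simp add: q_def powr_realpow[symmetric] powr_powr mult.commute)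
        finally show ?thesis .
      qed
      ultimately have eq: "2 ^ (n + 1) * s * (A / (2 ^ n * s)) powr p = 2 * (s * m) * q ^ n"
        by (simp add: algebra_simps)
      have "ennreal (2 ^ (n + 1) * s) * emeasure M {x. norm (g x) > 2 ^ n * s}
          \<le> ennreal (2 ^ (n + 1) * s) * ennreal ((A / (2 ^ n * s)) powr p)"
        using \<open>0 < s\<close> \<open>0 < A\<close>
        by (intro mult_left_mono distribution_le_if_weak_Lp_norm[OF weak _ \<open>1 < p\<close>]) auto
      also have "\<dots> = ennreal (2 * (s * m) * q ^ n)"
        unfolding eq[symmetric] using \<open>0 < s\<close> by (intro ennreal_mult[symmetric]) auto
      finally show ?thesis .
    qed
    have sets: "{x. norm (g x) > 2 ^ n * s} \<in> sets M" for n
    proof -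
      have "{x \<in> space M. norm (g x) > 2 ^ n * s} \<in> sets M"
        using g by measurable
      then show ?thesis
        by simp
    qed
    have "mass K g \<le> (\<integral>\<^sup>+x. ennreal s * indicator K x
        + (\<Sum>n. ennreal (2 ^ (n + 1) * s) * indicator {x. norm (g x) > 2 ^ n * s} x) \<partial>M)"
      unfolding mass_def
    proof (rule nn_integral_mono)
      fix x
      show "ennreal (norm (g x)) * indicator K x \<le> ennreal s * indicator K x
        + (\<Sum>n. ennreal (2 ^ (n + 1) * s) * indicator {x. norm (g x) > 2 ^ n * s} x)"
        using le_dyadic_layers[OF \<open>0 < s\<close>, of "norm (g x)"]
        by (cases "x \<in> K") (simp_all add: indicator_def)
    qed
    also have "\<dots> = ennreal s * emeasure M K
        + (\<Sum>n. ennreal (2 ^ (n + 1) * s) * emeasure M {x. norm (g x) > 2 ^ n * s})"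
      using sets compact_in_sets[OF K]
      by (simp add: nn_integral_add nn_integral_suminf nn_integral_cmult_indicator del: sets_M)
    also have "\<dots> \<le> ennreal (s * m) + (\<Sum>n. ennreal (2 * (s * m) * q ^ n))"
      using layer \<open>0 < s\<close> \<open>0 < m\<close>
      by (intro add_mono suminf_le) (auto simp: mK ennreal_mult)
    also have "(\<Sum>n. ennreal (2 * (s * m) * q ^ n)) = ennreal (2 * (s * m) * (1 / (1 - q)))"
      using q \<open>0 < s\<close> \<open>0 < m\<close>
      by (intro suminf_ennreal_eq sums_mult geometric_sums) auto
    also have "ennreal (s * m) + \<dots> = ennreal (s * m * layer_const p)"
      using q \<open>0 < s\<close> \<open>0 < m\<close>
      by (simp add: layer_const_def flip: ennreal_plus q_def) (simp add: distrib_left)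
    also have "\<dots> = ennreal (A * layer_const p) * ennreal (measure M K powr (1 - 1 / p))"
    proof -
      have "s * m * layer_const p = A * layer_const p * measure M K powr (1 - 1 / p)"
        unfolding sm by (simp add: m_def)
      then show ?thesis
        using layer_const_pos[OF \<open>1 < p\<close>] \<open>0 < A\<close> by (simp add: ennreal_mult ac_simps)
    qed
    finally show ?thesis .
  qed
qed

lemma weak_Lp_iff_mean_bound:
  assumes "1 < p"
  shows "k \<in> weak_Lp M p \<longleftrightarrow> k \<in> borel_measurable M \<and> (\<exists>c\<ge>0. mean_bound p (ennreal c) k)"
proof
  assume "k \<in> weak_Lp M p"
  then have k: "k \<in> borel_measurable M" "weak_Lp_norm M p k < \<infinity>"
    by (auto simp: weak_Lp_def)
  define A where "A = enn2real (weak_Lp_norm M p k) + 1"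
  have "0 < A"
    by (simp add: A_def add_nonneg_pos)
  moreover have "weak_Lp_norm M p k \<le> ennreal A"
    using k(2) unfolding A_def
    by (cases "weak_Lp_norm M p k" rule: ennreal_cases) (auto intro!: ennreal_leI)
  ultimately have "mean_bound p (ennreal (A * layer_const p)) k"
    using k(1) assms by (intro mean_bound_if_weak_Lp_norm)
  moreover have "0 \<le> A * layer_const p"
    using \<open>0 < A\<close> layer_const_pos[OF assms] by simp
  ultimately show "k \<in> borel_measurable M \<and> (\<exists>c\<ge>0. mean_bound p (ennreal c) k)"
    using k(1) by blast
next
  assume "k \<in> borel_measurable M \<and> (\<exists>c\<ge>0. mean_bound p (ennreal c) k)"
  then obtain c where "k \<in> borel_measurable M" "0 \<le> c" "mean_bound p (ennreal c) k"
    by blast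
  then show "k \<in> weak_Lp M p"
    using weak_Lp_norm_le_if_mean_bound[OF _ _ _ assms, of k c]
    by (auto simp: weak_Lp_def intro: order_le_less_trans)
qed

section \<open>Convolution with a kernel in the weak space\<close>

text \<open>
  Formally \<open>\<integral>\<^sub>K \<bar>k * f\<bar> \<le> \<integral> \<bar>f(z)\<bar> (\<integral>\<^sub>K \<bar>k(x - z)\<bar> dx) dz\<close>, and the inner integral is the integral
  of \<open>\<bar>k\<bar>\<close> over the translate \<open>K - z\<close>, which is at most \<open>c \<mu>(K - z)\<^bsup>1-1/p\<^esup> = c \<mu>(K)\<^bsup>1-1/p\<^esup>\<close> by right
  invariance. To interchange the integrals, \<open>k\<close> is replaced on \<open>L = K - S\<close>, where \<open>S\<close> contains
  the support of \<open>f\<close>, by \<open>h\<close> in \<open>Cc\<close> within \<open>e\<close> in \<open>L\<^sup>1\<close>. The replacement costs \<open>e \<parallel>f\<parallel>\<^sub>1\<close> in \<open>k *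
  f\<close>, and \<open>e\<close> in the integral over each translate.
\<close>

lemma mean_bound_convolution:
  assumes k: "k \<in> borel_measurable M" "mean_bound p c k" "c < \<infinity>" and f: "f \<in> Cc"
  shows "mean_bound p (c * mass UNIV f) (convolution M k f)"
  unfolding mean_bound_def
proof (intro allI impI)
  fix K :: "'a set" assume K: "compact K"
  define w where "w = ennreal (measure M K powr (1 - 1 / p))"
  have k_loc: "locally_integrable k"
    by (rule mean_bound_imp_locally_integrable[OF k])
  obtain S where S: "compact S" "\<And>x. x \<notin> S \<Longrightarrow> f x = 0"
    using Cc_supportE[OF f] by blast
  define L where "L = (\<lambda>(x, z). x - z) ` (K \<times> S)"
  have L: "compact L"
    unfolding L_def by (intro compact_diff_image K S(1))
  have "mass K (convolution M k f) \<le> c * w * mass UNIV f"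
  proof (rule ennreal_le_scaled_epsilon)
    show "2 * mass UNIV f < \<infinity>"
      using Cc_integrable[OF f] by (simp add: integrable_iff_mass ennreal_mult_less_top)
    fix e :: real assume "0 < e"
    obtain h where h: "h \<in> Cc" "mass UNIV (\<lambda>y. indicator L y * k y - h y) \<le> ennreal e"
      using Cc_approx_on_compactE[OF k_loc L \<open>0 < e\<close>] by blast
    have kL: "(\<lambda>y. indicator L y * k y) \<in> borel_measurable M"
      using locally_integrable_cut[OF k_loc L] by auto
    have h_loc: "locally_integrable h"
      by (rule integrable_imp_locally_integrable[OF Cc_integrable[OF h(1)]])
    have shift: "mass K (\<lambda>x. h (x - z)) \<le> ennreal e + c * w" if "z \<in> S" for z
    proof -
      let ?K = "(\<lambda>x. x - z) ` K"
      have K': "compact ?K"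
        by (intro compact_continuous_image K continuous_intros)
      have "mass K (\<lambda>x. h (x - z)) = mass ?K (\<lambda>y. (h y - indicator L y * k y) + indicator L y * k y)"
        by (simp add: mass_translate[OF Cc_borel[OF h(1)] K])
      also have "\<dots> \<le> mass ?K (\<lambda>y. h y - indicator L y * k y) + mass ?K (\<lambda>y. indicator L y * k y)"
        using kL Cc_borel[OF h(1)] compact_in_sets[OF K']
        by (intro mass_add borel_measurable_diff) auto
      also have "\<dots> \<le> ennreal e + c * w"
      proof (rule add_mono)
        have "mass ?K (\<lambda>y. h y - indicator L y * k y) \<le> mass UNIV (\<lambda>y. h y - indicator L y * k y)"
          by (rule mass_mono_set) simp
        also have "\<dots> \<le> ennreal e"
          using h(2) by (subst mass_minus_commute)
        finally show "mass ?K (\<lambda>y. h y - indicator L y * k y) \<le> ennreal e" .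
        have "mass ?K (\<lambda>y. indicator L y * k y) \<le> mass ?K k"
          by (rule mass_mono) (auto simp: indicator_def)
        also have "\<dots> \<le> c * w"
          using mean_boundD[OF k(2) K'] emeasure_translate[OF K, of z]
          by (simp add: w_def measure_def)
        finally show "mass ?K (\<lambda>y. indicator L y * k y) \<le> c * w" .
      qed
      finally show ?thesis .
    qed
    have "mass K (convolution M k f)
        = mass K (\<lambda>x. (convolution M k f x - convolution M h f x) + convolution M h f x)"
      by simp
    also have "\<dots> \<le> mass K (\<lambda>x. convolution M k f x - convolution M h f x) + mass K (convolution M h f)"
      by (intro mass_add borel_measurable_diff convolution_borel k_loc h_loc f compact_in_sets K)
    also have "\<dots> \<le> mass UNIV f * ennreal e + (ennreal e + c * w) * mass UNIV f"
    proof (rule add_mono)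
      show "mass K (\<lambda>x. convolution M k f x - convolution M h f x) \<le> mass UNIV f * ennreal e"
        by (rule mass_convolution_approx[OF k_loc h(1) f K S L eq_refl[OF L_def[symmetric]] h(2)])
      show "mass K (convolution M h f) \<le> (ennreal e + c * w) * mass UNIV f"
        by (rule mass_convolution_Cc[OF h(1) f S K shift])
    qed
    also have "\<dots> = c * w * mass UNIV f + 2 * mass UNIV f * ennreal e"
      by (simp add: algebra_simps mult_2)
    finally show "mass K (convolution M k f) \<le> c * w * mass UNIV f + 2 * mass UNIV f * ennreal e" .
  qed
  then show "mass K (convolution M k f) \<le> c * mass UNIV f * ennreal (measure M K powr (1 - 1 / p))"
    by (simp add: w_def ac_simps)
qed

text \<open>
  Candidates for the value at \<open>f\<close> of the extended operator. Comparing with all \<open>u\<close> in \<open>Cc\<close> at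
  once, instead of a chosen approximating sequence, makes the norm bound, linearity and
  agreement on \<open>Cc\<close> special choices of \<open>u\<close>.
\<close>

definition extension_value ::
    "real \<Rightarrow> ennreal \<Rightarrow> ('a \<Rightarrow> complex) \<Rightarrow> ('a \<Rightarrow> complex) \<Rightarrow> ('a \<Rightarrow> complex) \<Rightarrow> bool" where
  "extension_value p c k f h \<longleftrightarrow> h \<in> borel_measurable M \<and>
     (\<forall>u\<in>Cc. mean_bound p (c * mass UNIV (\<lambda>z. f z - u z)) (\<lambda>x. h x - convolution M k u x))"

text \<open>
  Completeness: if \<open>u n \<rightarrow> f\<close> geometrically fast in \<open>L\<^sup>1\<close>, then the increments of \<open>k * u n\<close> are
  absolutely summable in \<open>L\<^sup>1(K)\<close> for every compact \<open>K\<close>, hence almost everywhere, and their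
  pointwise limit \<open>h\<close> inherits the bounds by Fatou's lemma.
\<close>

lemma extension_value_exists:
  assumes k: "k \<in> borel_measurable M" "mean_bound p c k" "c < \<infinity>" and f: "integrable M f"
  shows "\<exists>h. extension_value p c k f h"
proof -
  have k_loc: "locally_integrable k"
    by (rule mean_bound_imp_locally_integrable[OF k])
  have f_meas: "f \<in> borel_measurable M"
    using f by auto
  have "\<forall>n. \<exists>u\<in>Cc. mass UNIV (\<lambda>x. f x - u x) \<le> ennreal ((1 / 2) ^ n)"
    using Cc_dense_L1[OF f] by simp
  then obtain u where u: "\<And>n. u n \<in> Cc" "\<And>n. mass UNIV (\<lambda>x. f x - u n x) \<le> ennreal ((1 / 2) ^ n)"
    by metis
  define v where "v n = convolution M k (u n)" for n
  have v_meas [measurable]: "v n \<in> borel_measurable M" for n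
    unfolding v_def by (rule convolution_borel[OF k_loc u(1)])
  define d where "d n x = v (Suc n) x - v n x" for n x
  have d_meas [measurable]: "d n \<in> borel_measurable M" for n
    unfolding d_def by measurable
  \<comment> \<open>Used with \<open>g = u (Suc n)\<close> for convergence, and with arbitrary \<open>g\<close> for the bounds on the limit.\<close>
  have v_bound: "mass K (\<lambda>x. v n x - convolution M k g x)
      \<le> c * ennreal (measure M K powr (1 - 1 / p)) * (ennreal ((1 / 2) ^ n) + mass UNIV (\<lambda>z. f z - g z))"
    if "compact K" "g \<in> Cc" for K n g
  proof -
    have "mass K (\<lambda>x. v n x - convolution M k g x) = mass K (convolution M k (\<lambda>z. u n z - g z))"
      by (intro mass_cong) (simp add: v_def convolution_diff_right[OF k_loc u(1) that(2)])
    also have "\<dots> \<le> c * mass UNIV (\<lambda>z. u n z - g z) * ennreal (measure M K powr (1 - 1 / p))"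
      by (intro mean_boundD mean_bound_convolution k Cc_diff u(1) that)
    also have "\<dots> = c * ennreal (measure M K powr (1 - 1 / p)) * mass UNIV (\<lambda>z. u n z - g z)"
      by (simp add: ac_simps)
    also have "\<dots> \<le> c * ennreal (measure M K powr (1 - 1 / p))
        * (ennreal ((1 / 2) ^ n) + mass UNIV (\<lambda>z. f z - g z))"
    proof (rule mult_left_mono)
      have "mass UNIV (\<lambda>z. u n z - g z) \<le> mass UNIV (\<lambda>z. u n z - f z) + mass UNIV (\<lambda>z. f z - g z)"
        by (intro mass_triangle Cc_borel u(1) that(2) f_meas) simp
      also have "mass UNIV (\<lambda>z. u n z - f z) \<le> ennreal ((1 / 2) ^ n)"
        using u(2) by (subst mass_minus_commute)
      finally show "mass UNIV (\<lambda>z. u n z - g z) \<le> ennreal ((1 / 2) ^ n) + mass UNIV (\<lambda>z. f z - g z)"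
        by (simp add: add_right_mono)
    qed simp
    finally show ?thesis .
  qed
  define D where "D x = (\<Sum>n. ennreal (norm (d n x)))" for x
  have D_meas: "D \<in> borel_measurable M"
    unfolding D_def by measurable
  have "AE x in M. D x \<noteq> \<infinity>"
  proof (rule AE_if_AE_on_compact)
    have "D -` {\<infinity>} \<inter> space M \<in> sets M"
      using D_meas by (rule measurable_sets) simp
    then show "{x. \<not> D x \<noteq> \<infinity>} \<in> sets M"
      by (simp add: vimage_def)
    fix K :: "'a set" assume K: "compact K"
    have [measurable]: "K \<in> sets M"
      by (rule compact_in_sets[OF K])
    define b where "b = enn2real (c * ennreal (measure M K powr (1 - 1 / p)))"
    have b: "c * ennreal (measure M K powr (1 - 1 / p)) = ennreal b" "0 \<le> b"
      using k(3) by (simp_all add: b_def ennreal_mult_less_top less_top)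
    have d_bound: "mass K (d n) \<le> ennreal (2 * b * (1 / 2) ^ n)" for n
    proof -
      have "mass K (d n) = mass K (\<lambda>x. v n x - convolution M k (u (Suc n)) x)"
        unfolding d_def by (subst mass_minus_commute) (simp add: v_def)
      also have "\<dots> \<le> ennreal b * (ennreal ((1 / 2) ^ n) + mass UNIV (\<lambda>z. f z - u (Suc n) z))"
        using v_bound[OF K u(1)] by (simp add: b(1))
      also have "\<dots> \<le> ennreal b * (ennreal ((1 / 2) ^ n) + ennreal ((1 / 2) ^ n))"
      proof (intro mult_left_mono add_left_mono)
        have "ennreal ((1 / 2) ^ Suc n) \<le> ennreal ((1 / 2) ^ n)"
          by (intro ennreal_leI) simp
        then show "mass UNIV (\<lambda>z. f z - u (Suc n) z) \<le> ennreal ((1 / 2) ^ n)"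
          by (rule order_trans[OF u(2)])
      qed simp
      also have "\<dots> = ennreal (b * ((1 / 2) ^ n + (1 / 2) ^ n))"
        by (subst ennreal_mult) (use b(2) in \<open>simp_all flip: ennreal_plus\<close>)
      also have "\<dots> = ennreal (2 * b * (1 / 2) ^ n)"
        by (simp add: algebra_simps)
      finally show ?thesis .
    qed
    have "(\<integral>\<^sup>+x. D x * indicator K x \<partial>M)
        = (\<integral>\<^sup>+x. (\<Sum>n. ennreal (norm (d n x)) * indicator K x) \<partial>M)"
      unfolding D_def by (intro nn_integral_cong) (simp only: ennreal_suminf_multc)
    also have "\<dots> = (\<Sum>n. mass K (d n))"
      unfolding mass_def by (intro nn_integral_suminf) measurable
    also have "\<dots> \<le> (\<Sum>n. ennreal (2 * b * (1 / 2) ^ n))"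
      by (intro suminf_le d_bound) auto
    also have "\<dots> < \<infinity>"
    proof -
      have "summable (\<lambda>n. 2 * b * (1 / 2) ^ n)"
        by (intro summable_mult summable_geometric) simp
      then have "(\<Sum>n. ennreal (2 * b * (1 / 2) ^ n)) \<noteq> top"
        by (rule ennreal_suminf_neq_top) (use b(2) in simp)
      then show ?thesis
        unfolding infinity_ennreal_def by (simp only: less_top)
    qed
    finally have "AE x in M. D x * indicator K x \<noteq> \<infinity>"
      using D_meas by (intro nn_integral_PInf_AE borel_measurable_times) auto
    then show "AE x in M. x \<in> K \<longrightarrow> D x \<noteq> \<infinity>"
      by eventually_elim auto
  qed
  then have conv: "AE x in M. (\<lambda>n. v n x) \<longlonglongrightarrow> lim (\<lambda>n. v n x)"
  proof eventually_elim
    case (elim x)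
    then have "summable (\<lambda>n. norm (d n x))"
      unfolding D_def infinity_ennreal_def by (intro summable_suminf_not_top norm_ge_zero)
    then have "(\<lambda>n. \<Sum>i<n. d i x) \<longlonglongrightarrow> (\<Sum>i. d i x)"
      by (rule summable_LIMSEQ[OF summable_norm_cancel])
    then have "(\<lambda>n. (\<Sum>i<n. d i x) + v 0 x) \<longlonglongrightarrow> (\<Sum>i. d i x) + v 0 x"
      by (intro tendsto_add tendsto_const)
    moreover have "(\<Sum>i<n. d i x) + v 0 x = v n x" for n
      unfolding d_def by (subst sum_lessThan_telescope) simp
    ultimately have "convergent (\<lambda>n. v n x)"
      by (auto simp: convergent_def)
    then show ?case
      by (simp add: convergent_LIMSEQ_iff)
  qed
  define h where "h x = lim (\<lambda>n. v n x)" for x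
  have h_meas: "h \<in> borel_measurable M"
    unfolding h_def by measurable
  have "extension_value p c k f h"
    unfolding extension_value_def mean_bound_def
  proof (intro conjI ballI allI impI h_meas)
    fix g :: "'a \<Rightarrow> complex" and K :: "'a set" assume g: "g \<in> Cc" and K: "compact K"
    have [measurable]: "K \<in> sets M" "convolution M k g \<in> borel_measurable M"
      by (rule compact_in_sets[OF K], rule convolution_borel[OF k_loc g])
    define w where "w = c * ennreal (measure M K powr (1 - 1 / p))"
    have "mass K (\<lambda>x. h x - convolution M k g x)
        = (\<integral>\<^sup>+x. liminf (\<lambda>n. ennreal (norm (v n x - convolution M k g x)) * indicator K x) \<partial>M)"
      unfolding mass_def
    proof (rule nn_integral_cong_AE)
      show "AE x in M. ennreal (norm (h x - convolution M k g x)) * indicator K x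
          = liminf (\<lambda>n. ennreal (norm (v n x - convolution M k g x)) * indicator K x)"
        using conv
      proof eventually_elim
        case (elim x)
        then have "(\<lambda>n. v n x) \<longlonglongrightarrow> h x"
          by (simp add: h_def)
        then have lim: "(\<lambda>n. ennreal (norm (v n x - convolution M k g x)))
            \<longlonglongrightarrow> ennreal (norm (h x - convolution M k g x))"
          by (intro tendsto_ennrealI tendsto_norm tendsto_diff tendsto_const)
        show ?case
          by (cases "x \<in> K") (simp_all add: lim_imp_Liminf[OF sequentially_bot lim] Liminf_const)
      qed
    qed
    also have "\<dots> \<le> liminf (\<lambda>n. mass K (\<lambda>x. v n x - convolution M k g x))"
      unfolding mass_def by (rule nn_integral_liminf) measurable
    also have "\<dots> \<le> w * mass UNIV (\<lambda>z. f z - g z)"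
    proof (rule ennreal_le_scaled_epsilon)
      show "w < \<infinity>"
        using k(3) by (simp add: w_def ennreal_mult_less_top)
      fix e :: real assume "0 < e"
      have "(\<lambda>n. (1 / 2) ^ n :: real) \<longlonglongrightarrow> 0"
        by (intro LIMSEQ_power_zero) simp
      then have "eventually (\<lambda>n. (1 / 2) ^ n < e) sequentially"
        using \<open>0 < e\<close> by (rule order_tendstoD(2))
      then have "eventually (\<lambda>n. mass K (\<lambda>x. v n x - convolution M k g x)
          \<le> w * mass UNIV (\<lambda>z. f z - g z) + w * ennreal e) sequentially"
      proof eventually_elim
        case (elim n)
        have "mass K (\<lambda>x. v n x - convolution M k g x)
            \<le> w * (ennreal ((1 / 2) ^ n) + mass UNIV (\<lambda>z. f z - g z))"
          unfolding w_def by (rule v_bound[OF K g])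
        also have "\<dots> \<le> w * (ennreal e + mass UNIV (\<lambda>z. f z - g z))"
          using elim by (intro mult_left_mono add_right_mono ennreal_leI) auto
        finally show ?case
          by (simp add: distrib_left add.commute)
      qed
      then show "liminf (\<lambda>n. mass K (\<lambda>x. v n x - convolution M k g x))
          \<le> w * mass UNIV (\<lambda>z. f z - g z) + w * ennreal e"
        by (intro Liminf_le) auto
    qed
    finally show "mass K (\<lambda>x. h x - convolution M k g x)
        \<le> c * mass UNIV (\<lambda>z. f z - g z) * ennreal (measure M K powr (1 - 1 / p))"
      by (simp add: w_def ac_simps)
  qed
  then show ?thesis
    by blast
qed

definition convolution_extension ::
    "real \<Rightarrow> ennreal \<Rightarrow> ('a \<Rightarrow> complex) \<Rightarrow> ('a \<Rightarrow> complex) \<Rightarrow> 'a \<Rightarrow> complex" where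
  "convolution_extension p c k f = (SOME h. extension_value p c k f h)"

lemma convolution_extension_value:
  assumes "k \<in> borel_measurable M" "mean_bound p c k" "c < \<infinity>" "integrable M f"
  shows "extension_value p c k f (convolution_extension p c k f)"
  unfolding convolution_extension_def by (rule someI_ex[OF extension_value_exists[OF assms]])

text \<open>
  Each identity holds because, for \<open>u\<close> and \<open>v\<close> in \<open>Cc\<close> close to \<open>f\<close> and \<open>g\<close>, both sides are
  close to the same convolution. The norm bound is the defining property at \<open>u = 0\<close>, and
  agreement on \<open>Cc\<close> is the one at \<open>u = f\<close>.
\<close>

lemma convolution_extension_bounded_linear:
  assumes p: "1 < p" and k: "k \<in> borel_measurable M" "mean_bound p (ennreal c) k" "0 \<le> c"
  defines "T \<equiv> convolution_extension p (ennreal c) k"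
  shows "bounded_linear_L1_weak_Lp M p T"
    and "\<And>f. f \<in> Cc \<Longrightarrow> AE x in M. T f x = convolution M k f x"
proof -
  have c: "ennreal c < \<infinity>"
    by simp
  have k_loc: "locally_integrable k"
    by (rule mean_bound_imp_locally_integrable[OF k(1,2) c])
  have T_meas: "T f \<in> borel_measurable M" if "integrable M f" for f
    using convolution_extension_value[OF k(1,2) c that]
    by (simp add: T_def extension_value_def)
  have T_bound: "mean_bound p (ennreal c * mass UNIV (\<lambda>z. f z - u z)) (\<lambda>x. T f x - convolution M k u x)"
    if "integrable M f" "u \<in> Cc" for f u
    using convolution_extension_value[OF k(1,2) c that(1)] that(2)
    by (simp add: T_def extension_value_def)
  have T_bound': "mean_bound p (ennreal c * ennreal e) (\<lambda>x. T f x - convolution M k u x)"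
    if "integrable M f" "u \<in> Cc" "mass UNIV (\<lambda>z. f z - u z) \<le> ennreal e" for f u e
    by (rule mean_bound_mono[OF T_bound[OF that(1,2)]]) (intro mult_left_mono that(3), simp)
  have conv_meas: "convolution M k u \<in> borel_measurable M" if "u \<in> Cc" for u
    by (rule convolution_borel[OF k_loc that])
  show T_Cc: "AE x in M. T f x = convolution M k f x" if f: "f \<in> Cc" for f
  proof (rule AE_eq_if_close_to_common[OF T_meas[OF Cc_integrable[OF f]] conv_meas[OF f] c])
    fix e :: real assume "0 < e"
    have "mean_bound p (ennreal c * ennreal e) (\<lambda>x. T f x - convolution M k f x)"
      by (rule T_bound'[OF Cc_integrable[OF f] f]) (simp add: mass_def)
    moreover have "mean_bound p (ennreal c * ennreal e) (\<lambda>x. convolution M k f x - convolution M k f x)"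
      by (simp add: mean_bound_def mass_def)
    ultimately show "\<exists>w\<in>borel_measurable M. mean_bound p (ennreal c * ennreal e) (\<lambda>x. T f x - w x)
        \<and> mean_bound p (ennreal c * ennreal e) (\<lambda>x. convolution M k f x - w x)"
      using conv_meas[OF f] by blast
  qed
  have weak: "weak_Lp_norm M p (T f) \<le> ennreal (c * (\<integral>x. norm (f x) \<partial>M))" if f: "integrable M f" for f
  proof (rule weak_Lp_norm_le_if_mean_bound[OF T_meas[OF f] _ _ p])
    have "mass UNIV f = ennreal (\<integral>x. norm (f x) \<partial>M)"
      unfolding mass_UNIV by (intro nn_integral_eq_integral integrable_norm f) simp
    moreover have "convolution M k (\<lambda>z. 0) x = 0" for x
      by (simp add: convolution_def)
    ultimately show "mean_bound p (ennreal (c * (\<integral>x. norm (f x) \<partial>M))) (T f)"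
      using T_bound[OF f Cc_zero] k(3) by (simp add: ennreal_mult)
  qed (simp add: k(3))
  have T_AE: "AE x in M. T f x = T g x"
    if f: "integrable M f" and g: "integrable M g" and eq: "AE x in M. f x = g x" for f g
  proof (rule AE_eq_if_close_to_common[OF T_meas[OF f] T_meas[OF g] c])
    fix e :: real assume "0 < e"
    obtain u where u: "u \<in> Cc" "mass UNIV (\<lambda>z. f z - u z) \<le> ennreal e"
      using Cc_dense_L1[OF f \<open>0 < e\<close>] by blast
    have "mass UNIV (\<lambda>z. g z - u z) = mass UNIV (\<lambda>z. f z - u z)"
      unfolding mass_UNIV using eq by (intro nn_integral_cong_AE) (auto elim!: eventually_mono)
    then have "mean_bound p (ennreal c * ennreal e) (\<lambda>x. T g x - convolution M k u x)"
      using T_bound'[OF g u(1)] u(2) by simp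
    then show "\<exists>w\<in>borel_measurable M. mean_bound p (ennreal c * ennreal e) (\<lambda>x. T f x - w x)
        \<and> mean_bound p (ennreal c * ennreal e) (\<lambda>x. T g x - w x)"
      using conv_meas[OF u(1)] T_bound'[OF f u] by blast
  qed
  have T_add: "AE x in M. T (\<lambda>z. f z + g z) x = T f x + T g x"
    if f: "integrable M f" and g: "integrable M g" for f g
  proof (rule AE_eq_if_close_to_common[of _ _ "2 * ennreal c"])
    have fg: "integrable M (\<lambda>z. f z + g z)"
      by (intro Bochner_Integration.integrable_add f g)
    show "T (\<lambda>z. f z + g z) \<in> borel_measurable M"
      by (rule T_meas[OF fg])
    show "(\<lambda>x. T f x + T g x) \<in> borel_measurable M"
      by (intro borel_measurable_add T_meas f g)
    show "2 * ennreal c < \<infinity>"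
      by (simp add: ennreal_mult_less_top)
    fix e :: real assume "0 < e"
    obtain u where u: "u \<in> Cc" "mass UNIV (\<lambda>z. f z - u z) \<le> ennreal e"
      using Cc_dense_L1[OF f \<open>0 < e\<close>] by blast
    obtain v where v: "v \<in> Cc" "mass UNIV (\<lambda>z. g z - v z) \<le> ennreal e"
      using Cc_dense_L1[OF g \<open>0 < e\<close>] by blast
    define w where "w = convolution M k (\<lambda>z. u z + v z)"
    have uv: "(\<lambda>z. u z + v z) \<in> Cc"
      by (rule Cc_add[OF u(1) v(1)])
    have "mass UNIV (\<lambda>z. f z + g z - (u z + v z)) = mass UNIV (\<lambda>z. (f z - u z) + (g z - v z))"
      by (intro mass_cong) simp
    also have "\<dots> \<le> mass UNIV (\<lambda>z. f z - u z) + mass UNIV (\<lambda>z. g z - v z)"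
      using f g Cc_borel[OF u(1)] Cc_borel[OF v(1)] by (intro mass_add borel_measurable_diff) auto
    also have "\<dots> \<le> ennreal e + ennreal e"
      by (intro add_mono u(2) v(2))
    also have "\<dots> = 2 * ennreal e"
      by (simp add: mult_2)
    finally have Tfg: "mean_bound p (ennreal c * (2 * ennreal e)) (\<lambda>x. T (\<lambda>z. f z + g z) x - w x)"
      unfolding w_def by (intro mean_bound_mono[OF T_bound[OF fg uv]] mult_left_mono) simp_all
    have "mean_bound p (ennreal c * ennreal e + ennreal c * ennreal e)
        (\<lambda>x. (T f x - convolution M k u x) + (T g x - convolution M k v x))"
      using T_meas[OF f] T_meas[OF g] conv_meas[OF u(1)] conv_meas[OF v(1)]
      by (intro mean_bound_add T_bound'[OF f u] T_bound'[OF g v]) auto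
    moreover have "(\<lambda>x. (T f x - convolution M k u x) + (T g x - convolution M k v x))
        = (\<lambda>x. T f x + T g x - w x)"
      by (simp add: w_def convolution_add_right[OF k_loc u(1) v(1)] fun_eq_iff)
    ultimately have Tf_Tg: "mean_bound p (ennreal c * ennreal e + ennreal c * ennreal e)
        (\<lambda>x. T f x + T g x - w x)"
      by simp
    have c2: "ennreal c * (2 * ennreal e) = 2 * ennreal c * ennreal e"
        "ennreal c * ennreal e + ennreal c * ennreal e = 2 * ennreal c * ennreal e"
      by (simp_all add: mult_2 distrib_left distrib_right)
    show "\<exists>w\<in>borel_measurable M.
        mean_bound p (2 * ennreal c * ennreal e) (\<lambda>x. T (\<lambda>z. f z + g z) x - w x)
        \<and> mean_bound p (2 * ennreal c * ennreal e) (\<lambda>x. T f x + T g x - w x)"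
      using Tfg Tf_Tg conv_meas[OF uv] unfolding c2 w_def by blast
  qed
  have T_cmult: "AE x in M. T (\<lambda>z. a * f z) x = a * T f x" if f: "integrable M f" for a f
  proof (rule AE_eq_if_close_to_common[of _ _ "ennreal (norm a) * ennreal c"])
    have af: "integrable M (\<lambda>z. a * f z)"
      by (intro integrable_mult_right f)
    show "T (\<lambda>z. a * f z) \<in> borel_measurable M"
      by (rule T_meas[OF af])
    show "(\<lambda>x. a * T f x) \<in> borel_measurable M"
      by (intro borel_measurable_times borel_measurable_const T_meas f)
    show "ennreal (norm a) * ennreal c < \<infinity>"
      by (simp add: ennreal_mult_less_top)
    fix e :: real assume "0 < e"
    obtain u where u: "u \<in> Cc" "mass UNIV (\<lambda>z. f z - u z) \<le> ennreal e"
      using Cc_dense_L1[OF f \<open>0 < e\<close>] by blast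
    define w where "w = convolution M k (\<lambda>z. a * u z)"
    have au: "(\<lambda>z. a * u z) \<in> Cc"
      by (rule Cc_cmult[OF u(1)])
    have "mass UNIV (\<lambda>z. a * f z - a * u z) = mass UNIV (\<lambda>z. a * (f z - u z))"
      by (intro mass_cong) (simp add: right_diff_distrib)
    also have "\<dots> = ennreal (norm a) * mass UNIV (\<lambda>z. f z - u z)"
      using f Cc_borel[OF u(1)] by (intro mass_cmult borel_measurable_diff) auto
    also have "\<dots> \<le> ennreal (norm a) * ennreal e"
      by (intro mult_left_mono u(2)) simp
    finally have "mean_bound p (ennreal c * (ennreal (norm a) * ennreal e)) (\<lambda>x. T (\<lambda>z. a * f z) x - w x)"
      unfolding w_def by (intro mean_bound_mono[OF T_bound[OF af au]] mult_left_mono) simp_all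
    moreover have "mean_bound p (ennreal (norm a) * (ennreal c * ennreal e))
        (\<lambda>x. a * (T f x - convolution M k u x))"
      using T_meas[OF f] conv_meas[OF u(1)] by (intro mean_bound_cmult T_bound'[OF f u]) auto
    moreover have "(\<lambda>x. a * (T f x - convolution M k u x)) = (\<lambda>x. a * T f x - w x)"
      by (simp add: w_def convolution_cmult_right right_diff_distrib)
    ultimately show "\<exists>w\<in>borel_measurable M.
        mean_bound p (ennreal (norm a) * ennreal c * ennreal e) (\<lambda>x. T (\<lambda>z. a * f z) x - w x)
        \<and> mean_bound p (ennreal (norm a) * ennreal c * ennreal e) (\<lambda>x. a * T f x - w x)"
      using conv_meas[OF au] by (intro bexI[of _ w]) (simp_all add: w_def ac_simps)
  qed
  show "bounded_linear_L1_weak_Lp M p T"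
    unfolding bounded_linear_L1_weak_Lp_def
  proof (intro conjI allI impI)
    show "T f \<in> weak_Lp M p" if "integrable M f" for f
      unfolding weak_Lp_def
      using T_meas[OF that] order_le_less_trans[OF weak[OF that], of \<infinity>] by simp
    show "\<exists>C::real. \<forall>f. integrable M f \<longrightarrow>
        weak_Lp_norm M p (T f) \<le> ennreal (C * (\<integral>x. norm (f x) \<partial>M))"
      using weak by (intro exI[of _ c]) simp
  qed (fact T_AE T_add T_cmult)+
qed

section \<open>Recovering the kernel from the operator\<close>

text \<open>
  If some nonempty open set were null, then finitely many translates of it would cover any
  compact set, so all compact sets would be null, and the whole group by inner regularity.
\<close>

lemma emeasure_open_nonzero:
  assumes "open U" "x0 \<in> U"
  shows "emeasure M U \<noteq> 0"
proof
  assume null: "emeasure M U = 0"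
  \<comment> \<open>The left translate of \<open>U\<close> that moves \<open>x0\<close> to \<open>g\<close>, so \<open>V g\<close> is an open neighbourhood of \<open>g\<close>.\<close>
  define V where "V g = (\<lambda>x. (x0 - g) + x) -` U" for g
  have V_open: "open (V g)" for g
    unfolding V_def by (intro open_vimage assms(1) continuous_intros)
  have V_null: "V g \<in> null_sets M" for g
  proof -
    have "emeasure M (V g) = emeasure (distr M M (\<lambda>x. (x0 - g) + x)) U"
      unfolding V_def using assms(1)
      by (subst emeasure_distr) (auto intro!: measurable_continuous_self continuous_intros)
    then show ?thesis
      using V_open null unfolding distr_translate_left by (intro null_setsI) auto
  qed
  have "emeasure M K = 0" if K: "compact K" for K
  proof -
    have "g \<in> V g" for g
      using assms(2) by (simp add: V_def)
    then have "K \<subseteq> (\<Union>g\<in>K. V g)"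
      by blast
    then obtain D where D: "D \<subseteq> K" "finite D" "K \<subseteq> (\<Union>g\<in>D. V g)"
      by (rule compactE_image[OF K V_open])
    have "(\<Union>g\<in>D. V g) \<in> null_sets M"
      using D(2) V_null by (intro null_sets_UN' countable_finite) auto
    then show ?thesis
      using null_sets_subset[OF _ compact_in_sets[OF K] D(3)] by auto
  qed
  then have "(SUP K\<in>{K. compact K \<and> K \<subseteq> UNIV}. emeasure M K) \<le> 0"
    by (intro SUP_least) simp
  moreover have "emeasure M UNIV = (SUP K\<in>{K. compact K \<and> K \<subseteq> UNIV}. emeasure M K)"
    by (rule inner_regular) simp
  ultimately have "emeasure M UNIV = 0"
    by (metis le_zero_eq)
  then show False
    using haar by (simp add: haar_measure_def)
qed

text \<open>
  Test with a bump function equal to \<open>1\<close> on the compact set \<open>- L + C\<close>, where \<open>C\<close> is a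
  neighbourhood of \<open>0\<close>. An interior point \<open>x\<close> of \<open>C\<close> where the integral converges exists because
  nonempty open sets are not null, and for this \<open>x\<close> the integrand equals \<open>k\<close> on \<open>L\<close>.
\<close>

lemma convolution_well_defined_imp_locally_integrable:
  assumes k: "k \<in> borel_measurable M" and wd: "convolution_well_defined M k"
  shows "locally_integrable k"
  unfolding locally_integrable_def
proof (intro conjI allI impI k)
  fix L :: "'a set" assume L: "compact L"
  obtain U C where UC: "open U" "compact C" "(0::'a) \<in> U" "U \<subseteq> C" "C \<subseteq> UNIV"
    by (rule compact_nbhd_inside[OF locally_compact open_UNIV UNIV_I])
  define Q where "Q = (\<lambda>(y, x). - y + x) ` (L \<times> C)"
  have "compact Q"
    unfolding Q_def
  proof (rule compact_continuous_image)
    show "continuous_on (L \<times> C) (\<lambda>(y, x). - y + x)"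
      unfolding case_prod_unfold by (intro continuous_intros)
  qed (intro compact_Times L UC(2))
  then obtain u :: "'a \<Rightarrow> real" where u: "(\<lambda>x. complex_of_real (u x)) \<in> Cc" "\<forall>x\<in>Q. u x = 1"
    using Cc_bump[OF locally_compact _ open_UNIV subset_UNIV] by blast
  have ae: "AE x in M. integrable M (\<lambda>y. k y * complex_of_real (u (- y + x)))"
    using wd u(1) by (auto simp: convolution_well_defined_def)
  obtain x where x: "x \<in> U" "integrable M (\<lambda>y. k y * complex_of_real (u (- y + x)))"
  proof (rule ccontr)
    assume none: "\<not> thesis"
    have "AE x in M. x \<notin> U"
      using ae by eventually_elim (use none that in blast)
    then have "emeasure M U = 0"
      using UC(1) by (subst (asm) AE_iff_measurable[of U]) auto
    then show False
      using emeasure_open_nonzero[OF UC(1,3)] by simp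
  qed
  have "mass L k = mass L (\<lambda>y. k y * complex_of_real (u (- y + x)))"
  proof (rule mass_cong)
    fix y assume "y \<in> L"
    then have "- y + x \<in> Q"
      unfolding Q_def using x(1) UC(4) by (intro image_eqI[of _ _ "(y, x)"]) auto
    then show "k y = k y * complex_of_real (u (- y + x))"
      using u(2) by simp
  qed
  also have "\<dots> \<le> mass UNIV (\<lambda>y. k y * complex_of_real (u (- y + x)))"
    by (rule mass_mono_set) simp
  also have "\<dots> < \<infinity>"
    using x(2) by (simp add: integrable_iff_mass)
  finally show "mass L k < \<infinity>" .
qed

lemma Cc_normalized_bump:
  assumes "open V" "(0::'a) \<in> V"
  shows "\<exists>f\<in>Cc. mass UNIV f = 1 \<and> (\<integral>z. f z \<partial>M) = 1 \<and> (\<forall>z. z \<notin> V \<longrightarrow> f z = 0)"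
proof -
  have "compact {0::'a}" "{0} \<subseteq> V"
    using assms by auto
  then obtain u :: "'a \<Rightarrow> real" where u: "(\<lambda>x. complex_of_real (u x)) \<in> Cc" "\<forall>x. 0 \<le> u x"
      "\<forall>x\<in>{0}. u x = 1" "\<forall>x. x \<notin> V \<longrightarrow> u x = 0"
    using Cc_bump[OF locally_compact _ assms(1)] by blast
  have u_int: "integrable M (\<lambda>x. complex_of_real (u x))"
    by (rule Cc_integrable[OF u(1)])
  then have u_int': "integrable M u"
    by (simp add: complex_of_real_integrable_eq)
  define m where "m = (\<integral>x. u x \<partial>M)"
  have mass_u: "mass UNIV (\<lambda>x. complex_of_real (u x)) = ennreal m"
    unfolding mass_UNIV m_def using u(2) u_int' by (simp add: nn_integral_eq_integral)
  have "0 \<le> m"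
    unfolding m_def using u(2) by (intro integral_nonneg_AE) auto
  moreover have "m \<noteq> 0"
  proof
    assume "m = 0"
    then have "(\<integral>\<^sup>+x. ennreal (norm (complex_of_real (u x))) \<partial>M) = 0"
      using mass_u by (simp add: mass_UNIV)
    moreover have "(\<lambda>x. ennreal (norm (complex_of_real (u x)))) \<in> borel_measurable M"
      by (rule measurable_compose[OF measurable_compose[OF Cc_borel[OF u(1)] borel_measurable_norm]
            measurable_ennreal])
    ultimately have "AE x in M. ennreal (norm (complex_of_real (u x))) = 0"
      by (simp only: nn_integral_0_iff_AE)
    then have ae: "AE x in M. x \<notin> {x. complex_of_real (u x) \<noteq> 0}"
      by eventually_elim simp
    have op: "open {x. complex_of_real (u x) \<noteq> 0}"
      by (intro open_Collect_neq Cc_continuous[OF u(1)] continuous_on_const)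
    have "emeasure M {x. complex_of_real (u x) \<noteq> 0} = 0"
      using ae op by (subst (asm) AE_iff_measurable[of "{x. complex_of_real (u x) \<noteq> 0}"]) auto
    moreover have "0 \<in> {x. complex_of_real (u x) \<noteq> 0}"
      using u(3) by simp
    ultimately show False
      using emeasure_open_nonzero[OF op] by blast
  qed
  ultimately have "0 < m"
    by simp
  define f where "f x = complex_of_real (1 / m) * complex_of_real (u x)" for x
  have "f \<in> Cc"
    unfolding f_def by (rule Cc_cmult[OF u(1)])
  moreover have "mass UNIV f = 1"
  proof -
    have "mass UNIV f = ennreal (norm (complex_of_real (1 / m))) * ennreal m"
      unfolding f_def mass_u[symmetric] using Cc_borel[OF u(1)] by (intro mass_cmult) auto
    also have "\<dots> = ennreal (1 / m * m)"
      using \<open>0 < m\<close> by (subst ennreal_mult) (simp_all add: norm_divide)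
    finally show ?thesis
      using \<open>0 < m\<close> by simp
  qed
  moreover have "(\<integral>z. f z \<partial>M) = 1"
  proof -
    have "(\<integral>z. f z \<partial>M) = complex_of_real (1 / m) * (\<integral>z. complex_of_real (u z) \<partial>M)"
      unfolding f_def by (rule integral_mult_right_zero)
    also have "\<dots> = complex_of_real (1 / m * m)"
      unfolding m_def by simp
    finally show ?thesis
      using \<open>0 < m\<close> by simp
  qed
  moreover have "f z = 0" if "z \<notin> V" for z
    using u(4) that by (simp add: f_def)
  ultimately show ?thesis
    by blast
qed

text \<open>
  For \<open>h\<close> in \<open>Cc\<close>, uniform continuity makes \<open>h * f - h\<close> uniformly small on \<open>K\<close> once \<open>f\<close> is
  concentrated near \<open>0\<close>. The general case follows because \<open>\<integral>\<^sub>K \<bar>(k - h) * f\<bar> \<le> \<integral>\<^sub>L \<bar>k - h\<bar>\<close> for \<open>L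
  = K - C\<close>, if \<open>f\<close> is supported in the compact neighbourhood \<open>C\<close> of \<open>0\<close>. That \<open>L\<close> is fixed
  before \<open>h\<close>, and \<open>h\<close> before the support of \<open>f\<close>, is essential.
\<close>

lemma approximate_identity:
  assumes k: "locally_integrable k" and K: "compact K" and e: "0 < (e :: real)"
  shows "\<exists>f\<in>Cc. mass UNIV f = 1 \<and> mass K (\<lambda>x. k x - convolution M k f x) \<le> 3 * ennreal e"
proof -
  obtain U C where UC: "open U" "compact C" "(0::'a) \<in> U" "U \<subseteq> C" "C \<subseteq> UNIV"
    by (rule compact_nbhd_inside[OF locally_compact open_UNIV UNIV_I])
  define L where "L = (\<lambda>(x, z). x - z) ` (K \<times> C)"
  have L: "compact L"
    unfolding L_def by (intro compact_diff_image K UC(2))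
  have "K \<subseteq> L"
  proof
    fix x assume "x \<in> K"
    then show "x \<in> L"
      unfolding L_def using UC(3,4) by (intro image_eqI[of _ _ "(x, 0)"]) auto
  qed
  obtain h where h: "h \<in> Cc" "mass UNIV (\<lambda>y. indicator L y * k y - h y) \<le> ennreal e"
    using Cc_approx_on_compactE[OF k L e] by blast
  \<comment> \<open>A uniform error \<open>d\<close> on \<open>K\<close> costs at most \<open>e\<close> in the integral; the summand \<open>1\<close> is for null \<open>K\<close>.\<close>
  define d where "d = e / (measure M K + 1)"
  have "0 < d"
    using e by (simp add: d_def add_nonneg_pos)
  have "continuous_on (UNIV \<times> K) (\<lambda>(z, x). h (x - z))"
    unfolding case_prod_unfold
    by (intro continuous_on_compose2[OF Cc_continuous[OF h(1)]] continuous_intros) auto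
  then obtain X where X: "0 \<in> X" "open X"
      "\<forall>z\<in>X \<inter> UNIV. \<forall>x\<in>K. dist ((\<lambda>(z, x). h (x - z)) (z, x)) ((\<lambda>(z, x). h (x - z)) (0, x)) \<le> d"
    by (rule continuous_on_prod_compactE[OF _ K UNIV_I \<open>0 < d\<close>])
  have "open (U \<inter> X)" "0 \<in> U \<inter> X"
    using UC X by auto
  then obtain f where f: "f \<in> Cc" "mass UNIV f = 1" "(\<integral>z. f z \<partial>M) = 1"
      "\<forall>z. z \<notin> U \<inter> X \<longrightarrow> f z = 0"
    using Cc_normalized_bump by blast
  have f_supp: "f z = 0" if "z \<notin> C" for z
    using that f(4) UC(4) by blast
  have h_loc: "locally_integrable h"
    by (rule integrable_imp_locally_integrable[OF Cc_integrable[OF h(1)]])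
  have conv_h: "norm (convolution M h f x - h x) \<le> d" if "x \<in> K" for x
  proof -
    have int1: "integrable M (\<lambda>z. f z * h (x - z))"
    proof (rule Cc_integrable, rule CcI[OF _ UC(2)])
      show "continuous_on UNIV (\<lambda>z. f z * h (x - z))"
        by (intro continuous_intros continuous_on_compose2[OF Cc_continuous[OF h(1)]]
            Cc_continuous[OF f(1)]) auto
    qed (simp add: f_supp)
    have int2: "integrable M (\<lambda>z. f z * h x)"
      by (intro integrable_mult_left Cc_integrable f(1))
    have "convolution M h f x - h x = (\<integral>z. f z * h (x - z) \<partial>M) - (\<integral>z. f z * h x \<partial>M)"
      using f(3) by (simp add: convolution_swap[OF h(1) f(1)])
    also have "\<dots> = (\<integral>z. f z * h (x - z) - f z * h x \<partial>M)"
      by (rule Bochner_Integration.integral_diff[OF int1 int2, symmetric])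
    finally have "ennreal (norm (convolution M h f x - h x))
        \<le> (\<integral>\<^sup>+z. ennreal (norm (f z * h (x - z) - f z * h x)) \<partial>M)"
      using integral_norm_bound_ennreal[OF Bochner_Integration.integrable_diff[OF int1 int2]] by simp
    also have "\<dots> \<le> mass UNIV (\<lambda>z. complex_of_real d * f z)"
      unfolding mass_UNIV
    proof (intro nn_integral_mono ennreal_leI)
      fix z
      show "norm (f z * h (x - z) - f z * h x) \<le> norm (complex_of_real d * f z)"
      proof (cases "z \<in> X")
        case True
        then have "norm (h (x - z) - h x) \<le> d"
          using X(3) that by (auto simp: dist_norm)
        then have "norm (f z) * norm (h (x - z) - h x) \<le> norm (f z) * d"
          by (rule mult_left_mono) simp
        then show ?thesis
          using \<open>0 < d\<close> by (simp add: norm_mult mult.commute flip: right_diff_distrib)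
      next
        case False
        then show ?thesis
          using f(4) by simp
      qed
    qed
    also have "\<dots> = ennreal d"
      using \<open>0 < d\<close> Cc_borel[OF f(1)] by (subst mass_cmult) (simp_all add: f(2))
    finally show ?thesis
      using \<open>0 < d\<close> by (simp add: ennreal_le_iff)
  qed
  have h_near: "mass K (\<lambda>x. h x - convolution M h f x) \<le> ennreal e"
  proof -
    have "mass K (\<lambda>x. h x - convolution M h f x) \<le> (\<integral>\<^sup>+x. ennreal d * indicator K x \<partial>M)"
      unfolding mass_def using conv_h
      by (intro nn_integral_mono) (auto simp: indicator_def norm_minus_commute intro!: ennreal_leI)
    also have "\<dots> = ennreal d * ennreal (measure M K)"
      using compact_in_sets[OF K] emeasure_compact_eq[OF K]
      by (simp add: nn_integral_cmult_indicator del: sets_M)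
    also have "\<dots> = ennreal (d * measure M K)"
      using \<open>0 < d\<close> by (simp add: ennreal_mult)
    also have "\<dots> \<le> ennreal e"
    proof (rule ennreal_leI)
      have "0 < measure M K + 1"
        by (simp add: add_nonneg_pos)
      then show "d * measure M K \<le> e"
        using e by (simp add: d_def divide_le_eq algebra_simps)
    qed
    finally show ?thesis .
  qed
  have k_near: "mass K (\<lambda>x. k x - h x) \<le> ennreal e"
  proof -
    have "mass K (\<lambda>x. k x - h x) = mass K (\<lambda>x. indicator L x * k x - h x)"
      using \<open>K \<subseteq> L\<close> by (intro mass_cong) auto
    also have "\<dots> \<le> mass UNIV (\<lambda>x. indicator L x * k x - h x)"
      by (rule mass_mono_set) simp
    finally show ?thesis
      using h(2) by (rule order_trans)
  qed
  have conv_near: "mass K (\<lambda>x. convolution M h f x - convolution M k f x) \<le> ennreal e"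
    using mass_convolution_approx[OF k h(1) f(1) K UC(2) f_supp L eq_refl[OF L_def[symmetric]] h(2)]
    by (simp add: f(2) mass_minus_commute[of K "convolution M h f"])
  have "mass K (\<lambda>x. k x - convolution M k f x)
      \<le> mass K (\<lambda>x. k x - h x) + mass K (\<lambda>x. h x - convolution M k f x)"
    by (intro mass_triangle locally_integrable_measurable k h_loc convolution_borel f(1) compact_in_sets K)
  also have "mass K (\<lambda>x. h x - convolution M k f x)
      \<le> mass K (\<lambda>x. h x - convolution M h f x) + mass K (\<lambda>x. convolution M h f x - convolution M k f x)"
    by (intro mass_triangle locally_integrable_measurable h_loc convolution_borel k f(1) compact_in_sets K)
  finally have "mass K (\<lambda>x. k x - convolution M k f x)
      \<le> mass K (\<lambda>x. k x - h x) + (mass K (\<lambda>x. h x - convolution M h f x)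
        + mass K (\<lambda>x. convolution M h f x - convolution M k f x))"
    by (simp add: add_left_mono)
  also have "\<dots> \<le> ennreal e + (ennreal e + ennreal e)"
    by (intro add_mono k_near h_near conv_near)
  also have "\<dots> = 3 * ennreal e"
    using e by (simp flip: ennreal_plus ennreal_numeral ennreal_mult)
  finally show ?thesis
    using f(1,2) by blast
qed

text \<open>
  The functions \<open>k * f\<close> with \<open>\<parallel>f\<parallel>\<^sub>1 = 1\<close> have a common mean bound, which is a closed condition
  for convergence in \<open>L\<^sup>1(K)\<close>. The maximum with \<open>1\<close> serves only to make the constant positive.
\<close>

lemma kernel_mean_bound_if_bounded:
  assumes p: "1 < p" and k: "locally_integrable k"
    and T: "bounded_linear_L1_weak_Lp M p T"
    and T_Cc: "\<And>f. f \<in> Cc \<Longrightarrow> AE x in M. T f x = convolution M k f x"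
  shows "\<exists>c\<ge>0. mean_bound p (ennreal c) k"
proof -
  note T' = T[unfolded bounded_linear_L1_weak_Lp_def]
  have T_weak: "T f \<in> weak_Lp M p" if "integrable M f" for f
    using conjunct1[OF T'] that by blast
  have "\<exists>C::real. \<forall>f. integrable M f \<longrightarrow>
      weak_Lp_norm M p (T f) \<le> ennreal (C * (\<integral>x. norm (f x) \<partial>M))"
    by (rule T'[THEN conjunct2, THEN conjunct2, THEN conjunct2, THEN conjunct2])
  then obtain C :: real where C: "\<forall>f. integrable M f \<longrightarrow>
      weak_Lp_norm M p (T f) \<le> ennreal (C * (\<integral>x. norm (f x) \<partial>M))"
    by (rule exE)
  define A where "A = max C 1"
  define c where "c = A * layer_const p"
  have "0 < A"
    by (simp add: A_def)
  then have "0 \<le> c"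
    using layer_const_pos[OF p] by (simp add: c_def)
  have "mean_bound p (ennreal c) k"
    unfolding mean_bound_def
  proof (intro allI impI)
    fix K :: "'a set" assume K: "compact K"
    show "mass K k \<le> ennreal c * ennreal (measure M K powr (1 - 1 / p))"
    proof (rule ennreal_le_scaled_epsilon)
      show "(3 :: ennreal) < \<infinity>"
        by simp
      fix e :: real assume "0 < e"
      obtain f where f: "f \<in> Cc" "mass UNIV f = 1"
          "mass K (\<lambda>x. k x - convolution M k f x) \<le> 3 * ennreal e"
        using approximate_identity[OF k K \<open>0 < e\<close>] by blast
      have f_int: "integrable M f"
        by (rule Cc_integrable[OF f(1)])
      have "ennreal (\<integral>x. norm (f x) \<partial>M) = mass UNIV f"
        unfolding mass_UNIV by (intro nn_integral_eq_integral[symmetric] integrable_norm f_int) simp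
      then have "(\<integral>x. norm (f x) \<partial>M) = 1"
        by (simp add: f(2) ennreal_eq_1)
      then have "weak_Lp_norm M p (T f) \<le> ennreal C"
        using C[rule_format, OF f_int] by simp
      also have "\<dots> \<le> ennreal A"
        by (intro ennreal_leI) (simp add: A_def)
      finally have "mean_bound p (ennreal c) (T f)"
        unfolding c_def using T_weak[OF f_int] \<open>0 < A\<close> p
        by (intro mean_bound_if_weak_Lp_norm) (auto simp: weak_Lp_def)
      moreover have "mass K (convolution M k f) = mass K (T f)"
        unfolding mass_def using T_Cc[OF f(1)]
        by (intro nn_integral_cong_AE) (auto elim!: eventually_mono)
      ultimately have conv: "mass K (convolution M k f) \<le> ennreal c * ennreal (measure M K powr (1 - 1 / p))"
        using mean_boundD[OF _ K] by simp
      have "mass K k = mass K (\<lambda>x. convolution M k f x + (k x - convolution M k f x))"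
        by simp
      also have "\<dots> \<le> mass K (convolution M k f) + mass K (\<lambda>x. k x - convolution M k f x)"
        by (intro mass_add borel_measurable_diff convolution_borel locally_integrable_measurable k f(1)
            compact_in_sets K)
      also have "\<dots> \<le> ennreal c * ennreal (measure M K powr (1 - 1 / p)) + 3 * ennreal e"
        by (intro add_mono conv f(3))
      finally show "mass K k \<le> ennreal c * ennreal (measure M K powr (1 - 1 / p)) + 3 * ennreal e" .
    qed
  qed
  with \<open>0 \<le> c\<close> show ?thesis
    by blast
qed

end

section \<open>The equivalence\<close>

theorem theorem1:
  fixes M :: "'a::{topological_group_add, t2_space} measure"
    and p :: real
    and k :: "'a \<Rightarrow> complex"
  assumes "locally_compact_space (euclidean :: 'a topology)"
    and "haar_measure M"
    and "inversion_invariant M"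
    and "1 < p"
    and "k \<in> borel_measurable M"
  shows "(convolution_well_defined M k \<and>
          (\<exists>T. bounded_linear_L1_weak_Lp M p T \<and>
               (\<forall>f\<in>Cc. AE x in M. T f x = convolution M k f x)))
         \<longleftrightarrow> k \<in> weak_Lp M p"
proof -
  interpret unimodular_haar_measure M
    by unfold_locales fact+
  show ?thesis
  proof
    assume "convolution_well_defined M k \<and>
      (\<exists>T. bounded_linear_L1_weak_Lp M p T \<and> (\<forall>f\<in>Cc. AE x in M. T f x = convolution M k f x))"
    then obtain T where wd: "convolution_well_defined M k" and T: "bounded_linear_L1_weak_Lp M p T"
        "\<And>f. f \<in> Cc \<Longrightarrow> AE x in M. T f x = convolution M k f x"
      by blast
    have "locally_integrable k"
      by (rule convolution_well_defined_imp_locally_integrable[OF assms(5) wd])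
    then show "k \<in> weak_Lp M p"
      using kernel_mean_bound_if_bounded[OF assms(4) _ T] assms(4,5)
      by (simp add: weak_Lp_iff_mean_bound)
  next
    assume "k \<in> weak_Lp M p"
    then obtain c where c: "0 \<le> c" "mean_bound p (ennreal c) k"
      using assms(4) by (auto simp: weak_Lp_iff_mean_bound)
    have "locally_integrable k"
      by (rule mean_bound_imp_locally_integrable[OF assms(5) c(2)]) simp
    then have "convolution_well_defined M k"
      unfolding convolution_well_defined_def by (intro ballI AE_I2 convolution_integrable)
    then show "convolution_well_defined M k \<and>
      (\<exists>T. bounded_linear_L1_weak_Lp M p T \<and> (\<forall>f\<in>Cc. AE x in M. T f x = convolution M k f x))"
      using convolution_extension_bounded_linear[OF assms(4,5) c(2,1)] by blast
  qed
qed

end
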